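(* Let $\Omega,\Omega'\subset\mathbb R^2$ be two strictly convex billiard domains with smooth boundaries of perimeter $1$, with billiard maps $\phi,\phi':\mathbb A\to\mathbb A$ and $\beta$-functions $\beta_\Omega,\beta_{\Omega'}:(0,1/2]\to\mathbb R$. If there is an exact symplectic diffeomorphism $\Phi:\mathbb A\to\mathbb A$ with $\Phi\circ\phi'=\phi\circ\Phi$, then $\beta_\Omega(h)=\beta_{\Omega'}(h)$ for all $h\in(0,1/2]$. That is, the $\beta$-function of a convex billiard map is a symplectic invariant.
   Context: Billiard map: let $\Omega\subset\mathbb R^2$ be a bounded strictly convex domain with smooth boundary of perimeter $1$, parametrized by arc length by $\xi:\mathbb R/\mathbb Z\to\partial\Omega$ with positive orientation, with everywhere positive curvature. Let $\mathbb A=(\mathbb R/\mathbb Z)\times[0,\pi]$. For $(s,v)\in\mathbb A$ with $0<v<\pi$, the ray starting at $\xi(s)$ and making angle $v$ with the positive tangent $\dot\xi(s)$ hits $\partial\Omega$ again at $\xi(\bar s)$ and is elastically reflected (angle of reflection equals angle of incidence); $\bar v$ is the angle of the reflected ray with $\dot\xi(\bar s)$. The billiard map is $\phi(s,v)=(\bar s,\bar v)$, extended by the identity to $v=0$ and $v=\pi$. Exact symplectic: let $\alpha=-\cos v\,ds$, so $d\alpha=\omega=\sin v\,dv\wedge ds$. A diffeomorphism $\Phi:\mathbb A\to\mathbb A$ is exact symplectic if $\Phi^*\alpha-\alpha=dg$ for some function $g$ on $\mathbb A$. $\beta$-function: put $h_\Omega(x,\bar x)=-\|\xi(x \bmod 1)-\xi(\bar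 x \bmod 1)\|$. For $p/q\in\mathbb Q\cap(0,1/2]$ in lowest terms, let $\mathcal C(s,p/q)$ be the set of real sequences $(x_0,\dots,x_q)$ with $x_0=s$, $x_q=s+p$ and $x_i\le x_{i+1}\le x_i+1$ for $0\le i<q$; define $$\mathcal B(s,p/q)=\min_{(x_i)\in\mathcal C(s,p/q)}\sum_{i=0}^{q-1}h_\Omega(x_i,x_{i+1}),\qquad \beta_\Omega(p/q)=\frac1q\min_{s\in[0,1]}\mathcal B(s,p/q).$$ For irrational $h\in(0,1/2]$, $\beta_\Omega(h)=\lim_{n\to\infty}\beta_\Omega(p_n/q_n)$ for any sequence of rationals $p_n/q_n\to h$. *)

theory Defs
  imports "HOL-Complex_Analysis.Complex_Analysis"
begin

subsection \<open>The circle and the annulus\<close>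

quotient_type circle = real / "\<lambda>x y::real. x - y \<in> \<int>"
  morphisms rep_circle circle_of
proof (rule equivpI)
  show "reflp (\<lambda>x y::real. x - y \<in> \<int>)"
    by (auto intro: reflpI)
  show "symp (\<lambda>x y::real. x - y \<in> \<int>)"
    by (rule sympI) (metis Ints_minus minus_diff_eq)
  show "transp (\<lambda>x y::real. x - y \<in> \<int>)"
    by (rule transpI) (metis Ints_add diff_add_cancel add_diff_eq)
qed

lemma circle_of_eq_iff: "circle_of x = circle_of y \<longleftrightarrow> x - y \<in> \<int>"
  by (rule circle.abs_eq_iff)

definition annulus :: "(circle \<times> real) set" where
  "annulus = UNIV \<times> {0..pi}"

definition strip :: "(real \<times> real) set" where
  "strip = UNIV \<times> {0..pi}"

definition annulus_proj :: "real \<times> real \<Rightarrow> circle \<times> real" where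
  "annulus_proj z = (circle_of (fst z), snd z)"

subsection \<open>Smooth maps\<close>

text \<open>Both predicates are intended for open \<open>S\<close>, since the derivatives are full two-sided ones.\<close>

primrec times_differentiable_on ::
    "nat \<Rightarrow> ('a::real_normed_vector \<Rightarrow> 'b::real_normed_vector) \<Rightarrow> 'a set \<Rightarrow> bool" where
  "times_differentiable_on 0 f S \<longleftrightarrow> continuous_on S f"
| "times_differentiable_on (Suc n) f S \<longleftrightarrow>
     (\<forall>x\<in>S. f differentiable (at x)) \<and>
     (\<forall>w. times_differentiable_on n (\<lambda>x. frechet_derivative f (at x) w) S)"

definition smooth_on ::
    "('a::real_normed_vector \<Rightarrow> 'b::real_normed_vector) \<Rightarrow> 'a set \<Rightarrow> bool" where
  "smooth_on f S \<longleftrightarrow> (\<forall>n. times_differentiable_on n f S)"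

text \<open>
  The charts of the annulus are the local inverses of \<open>annulus_proj\<close>, so \<open>F\<close> is a coordinate
  expression of \<open>\<Phi>\<close> over \<open>U\<close>. At the two boundary circles smoothness means, as usual for
  manifolds with boundary, that the coordinate expression extends smoothly to an open subset of
  the plane; nothing is required of \<open>F\<close> outside the strip beyond being smooth.
\<close>

definition local_lift ::
    "(circle \<times> real \<Rightarrow> circle \<times> real) \<Rightarrow> (real \<times> real) set \<Rightarrow> (real \<times> real \<Rightarrow> real \<times> real) \<Rightarrow> bool"
  where
  "local_lift \<Phi> U F \<longleftrightarrow>
     open U \<and> smooth_on F U \<and> (\<forall>z \<in> U \<inter> strip. annulus_proj (F z) = \<Phi> (annulus_proj z))"

definition smooth_annulus_map :: "(circle \<times> real \<Rightarrow> circle \<times> real) \<Rightarrow> bool" where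
  "smooth_annulus_map \<Phi> \<longleftrightarrow>
     \<Phi> \<in> annulus \<rightarrow> annulus \<and> (\<forall>z\<in>strip. \<exists>U F. z \<in> U \<and> local_lift \<Phi> U F)"

definition annulus_diffeomorphism :: "(circle \<times> real \<Rightarrow> circle \<times> real) \<Rightarrow> bool" where
  "annulus_diffeomorphism \<Phi> \<longleftrightarrow>
     bij_betw \<Phi> annulus annulus \<and>
     smooth_annulus_map \<Phi> \<and> smooth_annulus_map (inv_into annulus \<Phi>)"

subsection \<open>Exact symplectic diffeomorphisms\<close>

text \<open>The 1-form \<open>\<alpha> = - cos v ds\<close>, evaluated at a base point on a tangent vector.\<close>

definition alpha_form :: "real \<times> real \<Rightarrow> real \<times> real \<Rightarrow> real" where
  "alpha_form z w = - cos (snd z) * fst w"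

text \<open>
  \<open>\<Phi>\<^sup>*\<alpha> - \<alpha> = dg\<close>, written in local coordinates. Since \<open>alpha_form z\<close> depends only on \<open>snd z\<close>
  and two lifts of \<open>\<Phi>\<close> differ locally by an integer translation, the choice of the lift is
  immaterial. The primitive \<open>g\<close> is a function on the annulus itself, not merely on the strip.
\<close>

definition exact_symplectic :: "(circle \<times> real \<Rightarrow> circle \<times> real) \<Rightarrow> bool" where
  "exact_symplectic \<Phi> \<longleftrightarrow>
     annulus_diffeomorphism \<Phi> \<and>
     (\<exists>g :: circle \<times> real \<Rightarrow> real. \<forall>U F. local_lift \<Phi> U F \<longrightarrow>
        (\<forall>z \<in> U \<inter> strip.
           ((\<lambda>y. g (annulus_proj y)) has_derivative
             (\<lambda>w. alpha_form (F z) (frechet_derivative F (at z) w) - alpha_form z w))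
           (at z within strip)))"

subsection \<open>Billiard domains\<close>

text \<open>The Euclidean plane is identified with \<open>complex\<close>.\<close>

definition velocity :: "(circle \<Rightarrow> complex) \<Rightarrow> real \<Rightarrow> complex" where
  "velocity \<xi> x = vector_derivative (\<lambda>t. \<xi> (circle_of t)) (at x)"

text \<open>The signed curvature \<open>det (\<xi>', \<xi>'')\<close> of a curve of unit speed.\<close>

definition curvature :: "(circle \<Rightarrow> complex) \<Rightarrow> real \<Rightarrow> real" where
  "curvature \<xi> x = Im (cnj (velocity \<xi> x) * vector_derivative (velocity \<xi>) (at x))"

definition strictly_convex :: "complex set \<Rightarrow> bool" where
  "strictly_convex \<Omega> \<longleftrightarrow>
     (\<forall>x \<in> closure \<Omega>. \<forall>y \<in> closure \<Omega>. x \<noteq> y \<longrightarrow> open_segment x y \<subseteq> interior \<Omega>)"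

text \<open>
  \<open>\<xi>\<close> is an arc-length parametrization of the boundary of \<open>\<Omega>\<close>; that it is defined on the circle
  of length 1 makes the perimeter equal to 1.
\<close>

definition billiard_domain :: "complex set \<Rightarrow> (circle \<Rightarrow> complex) \<Rightarrow> bool" where
  "billiard_domain \<Omega> \<xi> \<longleftrightarrow>
     open \<Omega> \<and> \<Omega> \<noteq> {} \<and> bounded \<Omega> \<and> strictly_convex \<Omega> \<and>
     bij_betw \<xi> UNIV (frontier \<Omega>) \<and>
     smooth_on (\<lambda>x. \<xi> (circle_of x)) UNIV \<and>
     (\<forall>x. norm (velocity \<xi> x) = 1) \<and>
     (\<forall>z\<in>\<Omega>. winding_number (\<lambda>t. \<xi> (circle_of t)) z = 1) \<and>
     (\<forall>x. curvature \<xi> x > 0)"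

subsection \<open>The billiard map\<close>

definition tangent :: "(circle \<Rightarrow> complex) \<Rightarrow> circle \<Rightarrow> complex" where
  "tangent \<xi> s = velocity \<xi> (rep_circle s)"

text \<open>The reflection fixing the line spanned by the unit vector \<open>\<tau>\<close>.\<close>

definition reflect :: "complex \<Rightarrow> complex \<Rightarrow> complex" where
  "reflect \<tau> u = (2 * (u \<bullet> \<tau>)) *\<^sub>R \<tau> - u"

definition bounce :: "(circle \<Rightarrow> complex) \<Rightarrow> circle \<times> real \<Rightarrow> circle \<times> real \<Rightarrow> bool" where
  "bounce \<xi> = (\<lambda>(s, v) (s', v').
     (let u = cis v * tangent \<xi> s in
        s' \<noteq> s \<and> (\<exists>t>0. \<xi> s' = \<xi> s + t *\<^sub>R u) \<and>
        v' \<in> {0..pi} \<and> reflect (tangent \<xi> s') u = cis v' * tangent \<xi> s'))"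

definition billiard_map :: "(circle \<Rightarrow> complex) \<Rightarrow> circle \<times> real \<Rightarrow> circle \<times> real" where
  "billiard_map \<xi> z = (if 0 < snd z \<and> snd z < pi then (THE z'. bounce \<xi> z z') else z)"

subsection \<open>The beta function\<close>

definition h_fun :: "(circle \<Rightarrow> complex) \<Rightarrow> real \<Rightarrow> real \<Rightarrow> real" where
  "h_fun \<xi> x x' = - norm (\<xi> (circle_of x) - \<xi> (circle_of x'))"

text \<open>
  Sequences \<open>(x\<^sub>0, \<dots>, x\<^sub>q)\<close> are functions on \<open>nat\<close> of which only the values up to \<open>q\<close> matter.
  Minima of sets of reals are expressed by \<open>LEAST\<close>.
\<close>

definition configs :: "real \<Rightarrow> nat \<Rightarrow> nat \<Rightarrow> (nat \<Rightarrow> real) set" where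
  "configs s p q = {x. x 0 = s \<and> x q = s + real p \<and> (\<forall>i<q. x i \<le> x (Suc i) \<and> x (Suc i) \<le> x i + 1)}"

definition min_action :: "(circle \<Rightarrow> complex) \<Rightarrow> real \<Rightarrow> nat \<Rightarrow> nat \<Rightarrow> real" where
  "min_action \<xi> s p q =
     (LEAST b. b \<in> (\<lambda>x. \<Sum>i<q. h_fun \<xi> (x i) (x (Suc i))) ` configs s p q)"

definition beta_frac :: "(circle \<Rightarrow> complex) \<Rightarrow> nat \<Rightarrow> nat \<Rightarrow> real" where
  "beta_frac \<xi> p q = (LEAST b. b \<in> (\<lambda>s. min_action \<xi> s p q) ` {0..1}) / real q"

definition beta_rat :: "(circle \<Rightarrow> complex) \<Rightarrow> real \<Rightarrow> real" where
  "beta_rat \<xi> h =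
     (THE b. \<exists>p q. q > 0 \<and> coprime p q \<and> h = real p / real q \<and> b = beta_frac \<xi> p q)"

text \<open>Only meaningful for \<open>h\<close> in the interval \<open>(0, 1/2]\<close>.\<close>

definition beta :: "(circle \<Rightarrow> complex) \<Rightarrow> real \<Rightarrow> real" where
  "beta \<xi> h =
     (if h \<in> \<rat> then beta_rat \<xi> h
      else (THE l. \<forall>r :: nat \<Rightarrow> real.
              (\<forall>n. r n \<in> \<rat> \<inter> {0<..1/2}) \<and> r \<longlonglongrightarrow> h \<longrightarrow> (\<lambda>n. beta_rat \<xi> (r n)) \<longlonglongrightarrow> l))"

end

theory Submission
  imports Defs
begin

text \<open>
  Up to the factor \<open>q\<close>, the value of the beta function at \<open>p/q\<close> is minus the largest length of a
  closed billiard orbit with \<open>q\<close> bounces and rotation \<open>p\<close>: a length-maximizing configuration exists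
  by compactness, has no degenerate chords by the strict triangle inequality, and obeys the reflection
  law because the derivative of the length vanishes (\<open>minimal_config_closed_seq\<close>). A symplectic
  conjugacy preserves this number as it preserves the lengths of closed orbits and, up to reversing
  them, their rotations.

  For the lengths, let \<open>\<alpha> = - cos v ds\<close>, let \<open>L\<close> and \<open>L'\<close> be the lengths of the chords that
  start in a given state, and let \<open>\<Phi>\<^sup>*\<alpha> - \<alpha> = dg\<close>. The chord length generates the billiard map,
  that is \<open>\<phi>\<^sup>*\<alpha> - \<alpha> = - dL\<close>. Pulling this back by \<open>\<Phi>\<close> and using
  \<open>\<Phi> \<circ> \<phi>' = \<phi> \<circ> \<Phi>\<close> gives
  \<open>d (L' - L \<circ> \<Phi>) = d (g \<circ> \<phi>' - g)\<close>.
  Both sides tend to zero for shrinking chords, so \<open>L' - L \<circ> \<Phi> = g \<circ> \<phi>' - g\<close>, and the right-hand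
  side sums to zero along a closed orbit (\<open>length_cocycle\<close>). The computation is carried out in the
  coordinates \<open>(x, y)\<close> given by the end points of a chord. There the two states of the chord are
  explicit differentiable functions, and the differential of the length is read off directly.

  For the rotations, lift \<open>\<Phi>\<close> to the strip. The lift satisfies \<open>F (x + 1, v) = F (x, v) + (m, 0)\<close>,
  and it conjugates the lifted billiard maps up to a translation by \<open>k\<close>. The integer \<open>k\<close> is \<open>0\<close> or
  \<open>-1\<close>, again by looking at short chords (\<open>advance_integer_part\<close>). A closed orbit with rotation \<open>p\<close>
  is sent to one with rotation \<open>m p - k q\<close>. Because rotations lie strictly between \<open>0\<close> and \<open>q\<close>, and
  closed orbits with \<open>q = 3\<close> and \<open>p = 1, 2\<close> exist, this is \<open>p\<close> for all orbits or \<open>q - p\<close> for all orbits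
  (\<open>orbit_transfer\<close>). The minimal action is the same for \<open>p\<close> and \<open>q - p\<close>
  (\<open>beta_frac_reverse\<close>). Applying the correspondence in both directions gives equality at all rationals,
  and irrational values are limits of rational ones.
\<close>

section \<open>Smooth curves and the circle\<close>

lemma smooth_on_imp_continuous_on: "smooth_on f S \<Longrightarrow> continuous_on S f"
  unfolding smooth_on_def by (metis times_differentiable_on.simps(1))

lemma smooth_on_imp_differentiable: "smooth_on f S \<Longrightarrow> x \<in> S \<Longrightarrow> f differentiable (at x)"
  unfolding smooth_on_def by (metis times_differentiable_on.simps(2))

lemma smooth_on_frechet_derivative:
  assumes "smooth_on f S" shows "smooth_on (\<lambda>x. frechet_derivative f (at x) w) S"
  using assms unfolding smooth_on_def by (metis times_differentiable_on.simps(2))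

lemma smooth_curve_derivative:
  fixes f :: "real \<Rightarrow> 'a::real_normed_vector"
  assumes "smooth_on f UNIV"
  shows "(f has_vector_derivative vector_derivative f (at x)) (at x)"
    and "smooth_on (\<lambda>x. vector_derivative f (at x)) UNIV"
proof -
  have diff: "f differentiable (at x)" for x
    using smooth_on_imp_differentiable[OF assms] by simp
  then show "(f has_vector_derivative vector_derivative f (at x)) (at x)"
    by (simp add: vector_derivative_works)
  have "(\<lambda>x. vector_derivative f (at x)) = (\<lambda>x. frechet_derivative f (at x) 1)"
    using frechet_derivative_eq_vector_derivative[OF diff] by fastforce
  then show "smooth_on (\<lambda>x. vector_derivative f (at x)) UNIV"
    using smooth_on_frechet_derivative[OF assms] by simp
qed

lemma has_real_derivative_Im_mult:
  assumes "(f has_vector_derivative d) (at t)"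
  shows "((\<lambda>t. Im (c * f t)) has_real_derivative Im (c * d)) (at t)"
  unfolding has_real_derivative_iff_has_vector_derivative
  using bounded_linear.has_vector_derivative
    [OF bounded_linear_compose[OF bounded_linear_Im bounded_linear_mult_right] assms] .

lemma circle_of_rep_circle [simp]: "circle_of (rep_circle s) = s"
  by (metis Quotient_abs_rep Quotient_circle)

lemma circle_of_add_Ints [simp]: "n \<in> \<int> \<Longrightarrow> circle_of (x + n) = circle_of x"
  by (simp add: circle_of_eq_iff)

lemma annulus_proj_eq_iff:
  "annulus_proj z = annulus_proj z' \<longleftrightarrow> fst z - fst z' \<in> \<int> \<and> snd z = snd z'"
  by (simp add: annulus_proj_def circle_of_eq_iff)

lemma annulus_proj_in_annulus_iff [simp]: "annulus_proj z \<in> annulus \<longleftrightarrow> z \<in> strip"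
  by (cases z) (simp add: annulus_proj_def annulus_def strip_def)

lemma annulus_proj_rep_circle [simp]: "annulus_proj (rep_circle (fst z), snd z) = z"
  by (simp add: annulus_proj_def)

section \<open>Chords of a convex table\<close>

text \<open>
The frequently used data of a table, on the universal cover of the boundary circle. A state of the
billiard is encoded by a pair \<open>(x, y)\<close> with \<open>x < y < x + 1\<close>, the chord from parameter \<open>x\<close> to
parameter \<open>y\<close>; \<open>out_angle\<close> and \<open>in_angle\<close> are the angles at which the chord leaves \<open>x\<close> and arrives
at \<open>y\<close>. In these coordinates the chord length is the generating function of the billiard map, so no
formula for the map itself has to be differentiated.
\<close>

definition bdry :: "(circle \<Rightarrow> complex) \<Rightarrow> real \<Rightarrow> complex" where
  "bdry \<xi> x = \<xi> (circle_of x)"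

definition chord_dir :: "(circle \<Rightarrow> complex) \<Rightarrow> real \<Rightarrow> real \<Rightarrow> complex" where
  "chord_dir \<xi> x y = sgn (bdry \<xi> y - bdry \<xi> x)"

definition out_angle :: "(circle \<Rightarrow> complex) \<Rightarrow> real \<Rightarrow> real \<Rightarrow> real" where
  "out_angle \<xi> x y = arccos (chord_dir \<xi> x y \<bullet> velocity \<xi> x)"

definition in_angle :: "(circle \<Rightarrow> complex) \<Rightarrow> real \<Rightarrow> real \<Rightarrow> real" where
  "in_angle \<xi> x y = arccos (chord_dir \<xi> x y \<bullet> velocity \<xi> y)"

definition chords :: "(real \<times> real) set" where
  "chords = {(x, y). x < y \<and> y < x + 1}"

lemma sgn_scaleR_pos: "0 < c \<Longrightarrow> sgn (c *\<^sub>R z) = sgn (z :: 'a::real_normed_vector)"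
  by (simp add: sgn_scaleR)

text \<open>
The direction of a chord is a vector, but the billiard map and the form \<open>\<alpha>\<close> are expressed through
angles. The angle is recovered from its cosine by \<open>arccos\<close>, which is legitimate on the upper half
plane of the frame given by the tangent.
\<close>

lemma unit_complex_eq_cis_arccos:
  fixes u \<tau> :: complex
  assumes u: "norm u = 1" and \<tau>: "norm \<tau> = 1" and pos: "Im (cnj \<tau> * u) \<ge> 0"
  shows "cis (arccos (u \<bullet> \<tau>)) * \<tau> = u"
proof -
  define w where "w = cnj \<tau> * u"
  have w1: "norm w = 1" by (simp add: w_def norm_mult u \<tau>)
  have re: "Re w = u \<bullet> \<tau>" by (simp add: w_def inner_complex_def algebra_simps)
  have sq: "(Re w)\<^sup>2 + (Im w)\<^sup>2 = 1" using w1 by (simp add: cmod_def)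
  have rng: "-1 \<le> Re w" "Re w \<le> 1"
    using abs_Re_le_cmod[of w] w1 by auto
  have "sin (arccos (Re w)) = sqrt (1 - (Re w)\<^sup>2)" using rng by (rule sin_arccos)
  also have "\<dots> = Im w" using pos sq by (metis add_diff_cancel_left' real_sqrt_unique w_def)
  finally have "cis (arccos (Re w)) = w"
    using rng by (simp add: complex_eq_iff cos_arccos)
  moreover have "w * \<tau> = u"
    using \<tau> by (simp add: w_def complex_norm_square[symmetric] mult.commute mult.left_commute)
  ultimately show ?thesis by (simp add: re)
qed

lemma arccos_inner_in_open:
  fixes u \<tau> :: complex
  assumes u: "norm u = 1" and \<tau>: "norm \<tau> = 1" and pos: "Im (cnj \<tau> * u) \<noteq> 0"
  shows "\<bar>u \<bullet> \<tau>\<bar> < 1" "arccos (u \<bullet> \<tau>) \<in> {0<..<pi}"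
proof -
  define w where "w = cnj \<tau> * u"
  have "norm w = 1" by (simp add: w_def norm_mult u \<tau>)
  then have sq: "(Re w)\<^sup>2 + (Im w)\<^sup>2 = 1" by (simp add: cmod_def)
  have re: "Re w = u \<bullet> \<tau>" by (simp add: w_def inner_complex_def algebra_simps)
  have "(Im w)\<^sup>2 > 0" using pos by (simp add: w_def)
  then have "(Re w)\<^sup>2 < 1" using sq by linarith
  then show *: "\<bar>u \<bullet> \<tau>\<bar> < 1" by (simp add: re abs_square_less_1)
  then show "arccos (u \<bullet> \<tau>) \<in> {0<..<pi}"
    using arccos_lt_bounded[of "u \<bullet> \<tau>"] by auto
qed

lemma reflect_cis:
  assumes "norm \<tau> = 1" shows "reflect \<tau> (cis v * \<tau>) = cis (- v) * \<tau>"
proof -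
  have "(cis v * \<tau>) \<bullet> \<tau> = cos v * (norm \<tau>)\<^sup>2"
    unfolding cmod_power2 by (simp add: inner_complex_def algebra_simps power2_eq_square)
  then show ?thesis
    by (simp add: reflect_def assms complex_eq_iff algebra_simps)
qed

locale table =
  fixes \<Omega> :: "complex set" and \<xi> :: "circle \<Rightarrow> complex"
  assumes dom: "billiard_domain \<Omega> \<xi>"
begin

abbreviation "X \<equiv> bdry \<xi>"
abbreviation "\<tau> \<equiv> velocity \<xi>"

lemma opn: "open \<Omega>" and nonempty: "\<Omega> \<noteq> {}"
  and strict: "strictly_convex \<Omega>" and bij: "bij_betw \<xi> UNIV (frontier \<Omega>)"
  and norm_velocity [simp]: "norm (\<tau> x) = 1"
  and curvature_pos: "curvature \<xi> x > 0"
  using dom by (auto simp: billiard_domain_def)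

lemma velocity_nonzero [simp]: "\<tau> x \<noteq> 0"
  by (metis norm_velocity norm_zero zero_neq_one)

lemma smooth: "smooth_on X UNIV"
  using dom by (simp add: billiard_domain_def bdry_def[abs_def])

lemma bdry_add_Ints [simp]: "n \<in> \<int> \<Longrightarrow> X (x + n) = X x"
  by (simp add: bdry_def)

lemma bdry_eq_iff: "X x = X y \<longleftrightarrow> x - y \<in> \<int>"
  using bij unfolding bdry_def bij_betw_def inj_on_def by (metis UNIV_I circle_of_eq_iff)

lemma bdry_frontier: "X x \<in> frontier \<Omega>"
  using bij unfolding bdry_def bij_betw_def by auto

lemma frontier_not_in: "z \<in> frontier \<Omega> \<Longrightarrow> z \<notin> \<Omega>"
  using opn by (simp add: frontier_def interior_open)

lemma has_velocity: "(X has_vector_derivative \<tau> x) (at x)"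
  using smooth_curve_derivative(1)[OF smooth] by (simp add: velocity_def bdry_def[abs_def])

lemma smooth_velocity: "smooth_on \<tau> UNIV"
  using smooth_curve_derivative(2)[OF smooth] by (simp add: velocity_def[abs_def] bdry_def[abs_def])

lemma has_acceleration: "(\<tau> has_vector_derivative vector_derivative \<tau> (at x)) (at x)"
  using smooth_curve_derivative(1)[OF smooth_velocity] .

lemma continuous_bdry: "continuous_on S X" and continuous_velocity: "continuous_on S \<tau>"
  using smooth_on_imp_continuous_on[OF smooth] smooth_on_imp_continuous_on[OF smooth_velocity]
  by (auto intro: continuous_on_subset)

lemma velocity_add_Ints [simp]:
  assumes "n \<in> \<int>" shows "\<tau> (x + n) = \<tau> x"
proof -
  have "((X \<circ> (\<lambda>t. t + n)) has_vector_derivative (1 *\<^sub>R \<tau> (x + n))) (at x)"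
    by (rule vector_diff_chain_at) (auto intro!: derivative_eq_intros has_velocity)
  moreover have "X \<circ> (\<lambda>t. t + n) = X" using assms by auto
  ultimately show ?thesis
    using has_velocity vector_derivative_unique_at by (metis scaleR_one)
qed

lemma tangent_circle_of: "tangent \<xi> (circle_of x) = \<tau> x"
proof -
  have "rep_circle (circle_of x) - x \<in> \<int>" by (simp flip: circle_of_eq_iff)
  then show ?thesis
    using velocity_add_Ints[of "rep_circle (circle_of x) - x" x] by (simp add: tangent_def)
qed

lemma domain_convex: "convex \<Omega>"
proof -
  have "open_segment x y \<subseteq> \<Omega>" if "x \<in> \<Omega>" "y \<in> \<Omega>" for x y
    using strict that closure_subset interior_subset unfolding strictly_convex_def
    by (cases "x = y") (simp, blast)
  then show ?thesis by (auto simp: convex_contains_open_segment)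
qed

lemma open_segment_bdry: "open_segment (X x) (X y) \<subseteq> \<Omega>"
proof (cases "X x = X y")
  case False
  then show ?thesis
    using strict bdry_frontier interior_subset unfolding strictly_convex_def frontier_def
    by blast
qed simp

lemma not_between: "X z \<notin> open_segment (X x) (X y)"
  using open_segment_bdry bdry_frontier frontier_not_in by blast

text \<open>
A hyperplane that separates the open convex set \<open>\<Omega>\<close> from the boundary point is tangent to the
boundary curve, because the linear functional attains its minimum along the curve there.
\<close>

lemma supporting_line:
  obtains a where "\<And>z. z \<in> \<Omega> \<Longrightarrow> a \<bullet> (z - X x) > 0" "a \<bullet> \<tau> x = 0"
proof -
  have "convex {X x}" "{X x} \<noteq> {}" "{X x} \<inter> \<Omega> = {}"
    using bdry_frontier frontier_not_in by auto
  then obtain a b where a: "a \<noteq> 0" and "a \<bullet> X x \<le> b" and "\<forall>z\<in>\<Omega>. a \<bullet> z \<ge> b"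
    using separating_hyperplane_sets[of "{X x}" \<Omega>] domain_convex nonempty by auto
  then have weak: "z \<in> \<Omega> \<Longrightarrow> a \<bullet> (z - X x) \<ge> 0" for z
    by (auto simp: inner_diff_right)
  have pos: "a \<bullet> (z - X x) > 0" if z: "z \<in> \<Omega>" for z
  proof -
    obtain e where e: "e > 0" "cball z e \<subseteq> \<Omega>"
      using opn z open_contains_cball by blast
    have "z - (e / norm a) *\<^sub>R a \<in> \<Omega>"
      using e a by (intro subsetD[OF e(2)]) (simp add: dist_norm)
    from weak[OF this] have "(e / norm a) * (a \<bullet> a) \<le> a \<bullet> (z - X x)"
      by (simp add: inner_diff_right)
    moreover have "(e / norm a) * (a \<bullet> a) > 0" using e a by simp
    ultimately show ?thesis by linarith
  qed
  have cl: "a \<bullet> (z - X x) \<ge> 0" if z: "z \<in> closure \<Omega>" for z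
    by (rule continuous_ge_on_closure[OF _ z weak]) (intro continuous_intros)
  have "((\<lambda>t. X t - X x) has_vector_derivative \<tau> x) (at x)"
    using has_velocity by (auto intro!: derivative_eq_intros)
  then have der: "((\<lambda>t. a \<bullet> (X t - X x)) has_real_derivative a \<bullet> \<tau> x) (at x)"
    unfolding has_real_derivative_iff_has_vector_derivative
    by (rule bounded_linear.has_vector_derivative[OF bounded_linear_inner_right])
  have "a \<bullet> \<tau> x = 0"
    using DERIV_local_min[OF der zero_less_one] cl bdry_frontier by (simp add: frontier_def)
  with pos that show thesis by blast
qed

text \<open>
The one geometric fact from which all sign conditions follow. Strict convexity forbids that the
boundary meets one of its tangent lines a second time, so the signed distance from the tangent at
\<open>x\<close> has no zero on \<open>(x, x + 1)\<close>; positive curvature makes it positive just after \<open>x\<close>.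
\<close>

lemma left_of_tangent:
  assumes "x < y" "y < x + 1"
  shows "Im (cnj (\<tau> x) * (X y - X x)) > 0"
proof -
  define E where "E t = Im (cnj (\<tau> x) * (X t - X x))" for t
  have derE: "(E has_real_derivative Im (cnj (\<tau> x) * \<tau> t)) (at t)" for t
    unfolding E_def by (rule has_real_derivative_Im_mult) (auto intro!: derivative_eq_intros has_velocity)
  have contE: "continuous_on S E" for S
    using derE by (meson DERIV_continuous_on has_field_derivative_at_within)
  have derE': "((\<lambda>t. Im (cnj (\<tau> x) * \<tau> t)) has_real_derivative curvature \<xi> x) (at x)"
    unfolding curvature_def by (rule has_real_derivative_Im_mult[OF has_acceleration])
  obtain d where d: "d > 0" "\<And>h. 0 < h \<Longrightarrow> h < d \<Longrightarrow> Im (cnj (\<tau> x) * \<tau> x) < Im (cnj (\<tau> x) * \<tau> (x + h))"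
    using DERIV_pos_inc_right[OF derE' curvature_pos] by blast
  have E'x: "Im (cnj (\<tau> x) * \<tau> x) = 0" by simp
  \<comment> \<open>A second point on the tangent line would put the midpoint of the two points, which lies in the
    open set \<open>\<Omega>\<close>, on the supporting line.\<close>
  have nz: "E t \<noteq> 0" if t: "x < t" "t < x + 1" for t
  proof
    assume 0: "E t = 0"
    define r where "r = Re (cnj (\<tau> x) * (X t - X x))"
    have "cnj (\<tau> x) * (X t - X x) = of_real r"
      using 0 by (simp add: E_def r_def complex_eq_iff)
    then have "\<tau> x * cnj (\<tau> x) * (X t - X x) = of_real r * \<tau> x" by (simp add: ac_simps)
    then have on: "X t - X x = r *\<^sub>R \<tau> x"
      by (simp add: complex_norm_square[symmetric] scaleR_conv_of_real)
    have "x - t \<notin> \<int>" using Ints_nonzero_abs_less1[of "x - t"] t by auto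
    then have ne: "X x \<noteq> X t" by (simp add: bdry_eq_iff)
    obtain a where a: "\<And>z. z \<in> \<Omega> \<Longrightarrow> a \<bullet> (z - X x) > 0" "a \<bullet> \<tau> x = 0"
      using supporting_line by blast
    have "midpoint (X x) (X t) \<in> \<Omega>"
      using open_segment_bdry ne midpoint_in_open_segment by blast
    then have "a \<bullet> (midpoint (X x) (X t) - X x) > 0" by (rule a)
    also have "midpoint (X x) (X t) - X x = (1/2) *\<^sub>R (X t - X x)"
      by (simp add: midpoint_def algebra_simps scaleR_conv_of_real)
    finally show False using on a(2) by simp
  qed
  \<comment> \<open>A parameter close to \<open>x\<close> at which the curvature already decides the sign.\<close>
  define t where "t = x + min d (y - x) / 2"
  have t: "x < t" "t \<le> y" "t - x < d" using d(1) assms by (auto simp: t_def min_def field_simps)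
  obtain c where c: "x < c" "c < t" "E t - E x = (t - x) * Im (cnj (\<tau> x) * \<tau> c)"
    using MVT2[OF t(1), of E "\<lambda>c. Im (cnj (\<tau> x) * \<tau> c)"] derE by blast
  have "Im (cnj (\<tau> x) * \<tau> c) > 0" using d(2)[of "c - x"] c t E'x by auto
  then have Et: "E t > 0" using c t by (simp add: E_def)
  have "E y > 0"
  proof (rule ccontr)
    assume "\<not> E y > 0"
    then obtain s where "t \<le> s" "s \<le> y" "E s = 0"
      using IVT2'[of E y 0 t] Et t contE by auto
    with nz[of s] t assms show False by auto
  qed
  then show ?thesis by (simp add: E_def)
qed

text \<open>
Seen from its end point, the chord is the chord from \<open>y\<close> to \<open>x + 1\<close> traversed backwards.
\<close>

lemma right_of_tangent:
  assumes "x < y" "y < x + 1"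
  shows "Im (cnj (\<tau> y) * (X y - X x)) < 0"
proof -
  have "Im (cnj (\<tau> y) * (X (x + 1) - X y)) > 0" using left_of_tangent[of y "x + 1"] assms by simp
  moreover have "X (x + 1) = X x" by (rule bdry_add_Ints) simp
  ultimately show ?thesis by (simp add: algebra_simps)
qed

lemma bdry_distinct: "x < y \<Longrightarrow> y < x + 1 \<Longrightarrow> X y \<noteq> X x"
  using left_of_tangent[of x y] by auto

lemma norm_chord_dir: "x < y \<Longrightarrow> y < x + 1 \<Longrightarrow> norm (chord_dir \<xi> x y) = 1"
  using bdry_distinct by (simp add: chord_dir_def norm_sgn)

lemma chord_dir_left:
  assumes "x < y" "y < x + 1" shows "Im (cnj (\<tau> x) * chord_dir \<xi> x y) > 0"
proof -
  have "cnj (\<tau> x) * chord_dir \<xi> x y = (cnj (\<tau> x) * (X y - X x)) /\<^sub>R norm (X y - X x)"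
    by (simp add: chord_dir_def sgn_div_norm)
  then show ?thesis using left_of_tangent[OF assms] bdry_distinct[OF assms]
    by (simp add: zero_less_divide_iff divide_inverse_commute[symmetric] del: mult.commute)
qed

lemma chord_dir_right:
  assumes "x < y" "y < x + 1" shows "Im (cnj (\<tau> y) * chord_dir \<xi> x y) < 0"
proof -
  have "cnj (\<tau> y) * chord_dir \<xi> x y = (cnj (\<tau> y) * (X y - X x)) /\<^sub>R norm (X y - X x)"
    by (simp add: chord_dir_def sgn_div_norm)
  then show ?thesis using right_of_tangent[OF assms] bdry_distinct[OF assms]
    by (simp add: divide_less_0_iff divide_inverse_commute[symmetric] del: mult.commute)
qed

lemma out_angle_bounds:
  assumes "x < y" "y < x + 1"
  shows "out_angle \<xi> x y \<in> {0<..<pi}" "\<bar>chord_dir \<xi> x y \<bullet> \<tau> x\<bar> < 1"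
  using arccos_inner_in_open[OF norm_chord_dir[OF assms] norm_velocity[of x]] chord_dir_left[OF assms]
  by (auto simp: out_angle_def)

lemma in_angle_bounds:
  assumes "x < y" "y < x + 1"
  shows "in_angle \<xi> x y \<in> {0<..<pi}" "\<bar>chord_dir \<xi> x y \<bullet> \<tau> y\<bar> < 1"
  using arccos_inner_in_open[OF norm_chord_dir[OF assms] norm_velocity[of y]] chord_dir_right[OF assms]
  by (auto simp: in_angle_def)

lemma cos_angles:
  assumes "x < y" "y < x + 1"
  shows "cos (out_angle \<xi> x y) = chord_dir \<xi> x y \<bullet> \<tau> x" "cos (in_angle \<xi> x y) = chord_dir \<xi> x y \<bullet> \<tau> y"
  using out_angle_bounds(2)[OF assms] in_angle_bounds(2)[OF assms]
  by (auto simp: out_angle_def in_angle_def cos_arccos_abs)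

lemma cis_out_angle:
  assumes "x < y" "y < x + 1"
  shows "cis (out_angle \<xi> x y) * \<tau> x = chord_dir \<xi> x y"
  using unit_complex_eq_cis_arccos[OF norm_chord_dir[OF assms] norm_velocity[of x]] chord_dir_left[OF assms]
  by (auto simp: out_angle_def)

lemma cis_in_angle:
  assumes "x < y" "y < x + 1"
  shows "cis (- in_angle \<xi> x y) * \<tau> y = chord_dir \<xi> x y"
proof -
  define u where "u = cnj (chord_dir \<xi> x y)"
  have "cis (arccos (u \<bullet> cnj (\<tau> y))) * cnj (\<tau> y) = u"
  proof (rule unit_complex_eq_cis_arccos)
    have "Im (cnj (cnj (\<tau> y)) * u) = - Im (cnj (\<tau> y) * chord_dir \<xi> x y)"
      by (simp add: u_def)
    then show "0 \<le> Im (cnj (cnj (\<tau> y)) * u)"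
      using chord_dir_right[OF assms] by linarith
  qed (use norm_chord_dir[OF assms] in \<open>auto simp: u_def\<close>)
  moreover have "u \<bullet> cnj (\<tau> y) = chord_dir \<xi> x y \<bullet> \<tau> y" by (simp add: u_def inner_complex_def)
  ultimately have "cis (in_angle \<xi> x y) * cnj (\<tau> y) = u" by (simp add: in_angle_def)
  then have "cnj (cis (in_angle \<xi> x y) * cnj (\<tau> y)) = chord_dir \<xi> x y" by (simp add: u_def)
  then show ?thesis by (simp add: cis_cnj)
qed

text \<open>
Two chords from \<open>x\<close> in the same direction would give three collinear boundary points, the middle
one of which would lie inside the table.
\<close>

lemma chord_dir_inj:
  assumes "x < y" "y < x + 1" "x < z" "z < x + 1" "chord_dir \<xi> x y = chord_dir \<xi> x z"
  shows "y = z"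
proof (rule ccontr)
  assume ne: "y \<noteq> z"
  define a b where "a = norm (X y - X x)" "b = norm (X z - X x)"
  define u where "u = chord_dir \<xi> x y"
  have pos: "a > 0" "b > 0" using bdry_distinct[of x y] bdry_distinct[of x z] assms by (auto simp: a_b_def)
  have y: "X y = X x + a *\<^sub>R u"
    using pos by (simp add: u_def chord_dir_def a_b_def sgn_div_norm)
  have z: "X z = X x + b *\<^sub>R u"
    unfolding u_def assms(5) using pos by (simp add: chord_dir_def a_b_def sgn_div_norm)
  have "y - z \<notin> \<int>" using Ints_nonzero_abs_less1[of "y - z"] assms ne by (auto simp: abs_less_iff)
  then have "X y \<noteq> X z" by (simp add: bdry_eq_iff)
  then have "a \<noteq> b" using y z by auto
  have seg: "X x + c *\<^sub>R u \<in> open_segment (X x) (X x + d *\<^sub>R u)" if "0 < c" "c < d" for c d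
  proof -
    have "u \<noteq> 0" using norm_chord_dir[of x y] assms by (auto simp: u_def)
    then show ?thesis using that
      by (auto simp: in_segment intro!: exI[of _ "c / d"] simp: algebra_simps)
  qed
  show False
    using seg[of a b] seg[of b a] pos \<open>a \<noteq> b\<close> not_between[of y x z] not_between[of z x y] y z
    by (metis linorder_neqE_linordered_idom)
qed

lemma out_angle_inj:
  assumes "x < y" "y < x + 1" "x < z" "z < x + 1" "out_angle \<xi> x y = out_angle \<xi> x z"
  shows "y = z"
  using chord_dir_inj[OF assms(1-4)] cis_out_angle[of x y] cis_out_angle[of x z] assms by metis

lemma chord_dir_add_Ints [simp]: "n \<in> \<int> \<Longrightarrow> chord_dir \<xi> (x + n) (y + n) = chord_dir \<xi> x y"
  by (simp add: chord_dir_def)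

lemma angle_add_Ints [simp]:
  assumes "n \<in> \<int>"
  shows "out_angle \<xi> (x + n) (y + n) = out_angle \<xi> x y" "in_angle \<xi> (x + n) (y + n) = in_angle \<xi> x y"
  using assms by (simp_all add: out_angle_def in_angle_def)

text \<open>
In chord coordinates the billiard map sends the departure state of a chord to its arrival state.
\<close>

lemma billiard_map_chord:
  assumes xy: "x < y" "y < x + 1"
  shows "billiard_map \<xi> (annulus_proj (x, out_angle \<xi> x y)) = annulus_proj (y, in_angle \<xi> x y)"
proof -
  let ?v = "out_angle \<xi> x y" and ?w = "in_angle \<xi> x y"
  define u where "u = chord_dir \<xi> x y"
  have u: "cis ?v * \<tau> x = u"
    using cis_out_angle[OF xy] by (simp add: u_def)
  have refl: "reflect (\<tau> y) u = cis ?w * \<tau> y"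
    using reflect_cis[of "\<tau> y" "- ?w"] cis_in_angle[OF xy] by (simp add: u_def)
  have "bounce \<xi> (circle_of x, ?v) (circle_of y, ?w)"
  proof -
    have "circle_of y \<noteq> circle_of x" using bdry_distinct[OF xy] by (auto simp: bdry_def)
    moreover have "\<exists>t>0. \<xi> (circle_of y) = \<xi> (circle_of x) + t *\<^sub>R u"
      using bdry_distinct[OF xy]
      by (intro exI[of _ "norm (X y - X x)"]) (auto simp: u_def chord_dir_def sgn_div_norm bdry_def)
    moreover have "?w \<in> {0..pi}" using in_angle_bounds(1)[OF xy] by auto
    ultimately show ?thesis by (simp add: bounce_def Let_def u tangent_circle_of refl)
  qed
  moreover have "z' = (circle_of y, ?w)" if b: "bounce \<xi> (circle_of x, ?v) z'" for z'
  proof -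
    obtain s' v' where z': "z' = (s', v')" by fastforce
    define r where "r = rep_circle s'"
    \<comment> \<open>The representative of the hit point in the fundamental interval \<open>[x, x + 1)\<close>.\<close>
    define y' where "y' = r - of_int \<lfloor>r - x\<rfloor>"
    have y's: "circle_of y' = s'"
      using circle_of_add_Ints[of "- of_int \<lfloor>r - x\<rfloor>" r] by (simp add: y'_def r_def)
    from b have s': "s' \<noteq> circle_of x" and v': "v' \<in> {0..pi}"
      and ray: "\<exists>t>0. \<xi> s' = \<xi> (circle_of x) + t *\<^sub>R u"
      and rf: "reflect (tangent \<xi> s') u = cis v' * tangent \<xi> s'"
      by (auto simp: z' bounce_def Let_def u tangent_circle_of)
    have y': "x \<le> y'" "y' < x + 1" unfolding y'_def by linarith+
    have "y' \<noteq> x" using s' y's by auto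
    with y' have xy': "x < y'" by simp
    from ray obtain t where t: "t > 0" "X y' = X x + t *\<^sub>R u" by (auto simp: bdry_def y's)
    have "chord_dir \<xi> x y' = sgn u" using t by (simp add: chord_dir_def sgn_scaleR_pos)
    also have "\<dots> = u" by (simp add: u_def chord_dir_def)
    finally have "y' = y" using chord_dir_inj[OF xy' y'(2) xy] by (simp add: u_def)
    then have s'y: "s' = circle_of y" using y's by simp
    have "cis v' * \<tau> y = cis ?w * \<tau> y" using rf refl by (simp add: s'y tangent_circle_of)
    then have "cis v' = cis ?w" by simp
    then have "cos v' = cos ?w" by (metis cis.simps(1))
    then have "v' = ?w" using v' in_angle_bounds(1)[OF xy] by (metis atLeastAtMost_iff
          greaterThanLessThan_iff arccos_cos less_eq_real_def)
    then show ?thesis by (simp add: z' s'y)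
  qed
  ultimately have "(THE z'. bounce \<xi> (circle_of x, ?v) z') = (circle_of y, ?w)"
    by (rule the_equality)
  then show ?thesis using out_angle_bounds(1)[OF xy]
    by (simp add: billiard_map_def annulus_proj_def)
qed

section \<open>Continuity and differentiability of the chord coordinates\<close>



lemma sgn_difference_quotient: "((\<lambda>y. sgn ((X y - X x) /\<^sub>R (y - x))) \<longlongrightarrow> \<tau> x) (at x)"
proof -
  have "((\<lambda>y. (X y - X x) /\<^sub>R (y - x)) \<longlongrightarrow> \<tau> x) (at x)"
  proof (rule LIM_zero_cancel, rule tendsto_norm_zero_cancel, rule Lim_transform_eventually)
    show "((\<lambda>y. norm (X y - X x - (y - x) *\<^sub>R \<tau> x) / norm (y - x)) \<longlongrightarrow> 0) (at x)"
      using has_velocity[of x] by (simp add: has_vector_derivative_def has_derivative_iff_norm)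
    have "norm ((X y - X x) /\<^sub>R (y - x) - \<tau> x) = norm (X y - X x - (y - x) *\<^sub>R \<tau> x) / norm (y - x)"
      if "y \<noteq> x" for y
    proof -
      have "(X y - X x) /\<^sub>R (y - x) - \<tau> x = (X y - X x - (y - x) *\<^sub>R \<tau> x) /\<^sub>R (y - x)"
        using that by (simp add: scaleR_diff_right)
      then show ?thesis by (simp add: divide_inverse_commute)
    qed
    then show "\<forall>\<^sub>F y in at x. norm (X y - X x - (y - x) *\<^sub>R \<tau> x) / norm (y - x)
        = norm ((X y - X x) /\<^sub>R (y - x) - \<tau> x)"
      by (auto simp: eventually_at_filter)
  qed
  from tendsto_sgn[OF this velocity_nonzero] show ?thesis by (simp add: sgn_div_norm[of "\<tau> x"])
qed

lemma chord_dir_at_right: "((\<lambda>y. chord_dir \<xi> x y) \<longlongrightarrow> \<tau> x) (at_right x)"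
proof (rule Lim_transform_eventually)
  show "((\<lambda>y. sgn ((X y - X x) /\<^sub>R (y - x))) \<longlongrightarrow> \<tau> x) (at_right x)"
    using sgn_difference_quotient tendsto_within_subset by blast
  show "\<forall>\<^sub>F y in at_right x. sgn ((X y - X x) /\<^sub>R (y - x)) = chord_dir \<xi> x y"
    by (auto simp: eventually_at_filter chord_dir_def sgn_scaleR_pos)
qed

text \<open>
A chord to a point just before \<open>x + 1\<close> is a chord to a point just before \<open>x\<close>, hence points
backwards along the tangent.
\<close>

lemma chord_dir_at_left: "((\<lambda>y. chord_dir \<xi> x y) \<longlongrightarrow> - \<tau> x) (at_left (x + 1))"
proof (rule Lim_transform_eventually)
  have 1: "X (x + 1) = X x" "\<tau> (x + 1) = \<tau> x" by simp_all
  have "((\<lambda>y. sgn ((X y - X x) /\<^sub>R (y - (x + 1)))) \<longlongrightarrow> \<tau> x) (at_left (x + 1))"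
    using sgn_difference_quotient[of "x + 1"] tendsto_within_subset unfolding 1 by blast
  then show "((\<lambda>y. - sgn ((X y - X x) /\<^sub>R (y - (x + 1)))) \<longlongrightarrow> - \<tau> x) (at_left (x + 1))"
    by (rule tendsto_minus)
  show "\<forall>\<^sub>F y in at_left (x + 1). - sgn ((X y - X x) /\<^sub>R (y - (x + 1))) = chord_dir \<xi> x y"
    by (auto simp: eventually_at_filter chord_dir_def sgn_scaleR)
qed

lemma abs_inner_unit: "norm u \<le> 1 \<Longrightarrow> norm v = 1 \<Longrightarrow> \<bar>u \<bullet> (v::complex)\<bar> \<le> 1"
  using Cauchy_Schwarz_ineq2[of u v] by auto

lemma norm_chord_dir_le: "norm (chord_dir \<xi> x y) \<le> 1"
  by (simp add: chord_dir_def norm_sgn)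

lemma angle_limit:
  assumes "((\<lambda>y. chord_dir \<xi> x y) \<longlongrightarrow> u) F" "(\<sigma> \<longlongrightarrow> v) F" "norm u \<le> 1" "norm v = 1" "\<And>y. norm (\<sigma> y) = 1"
  shows "((\<lambda>y. arccos (chord_dir \<xi> x y \<bullet> \<sigma> y)) \<longlongrightarrow> arccos (u \<bullet> v)) F"
proof (rule continuous_on_tendsto_compose[OF continuous_on_arccos'])
  show "((\<lambda>y. chord_dir \<xi> x y \<bullet> \<sigma> y) \<longlongrightarrow> u \<bullet> v) F"
    by (intro tendsto_inner assms)
qed (use abs_inner_unit assms norm_chord_dir_le in \<open>auto simp: abs_le_iff intro!: always_eventually\<close>)

lemma inner_velocity_self [simp]: "\<tau> x \<bullet> \<tau> x = 1"
  using norm_velocity[of x] by (simp add: dot_square_norm)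

lemma out_angle_at_right: "((\<lambda>y. out_angle \<xi> x y) \<longlongrightarrow> 0) (at_right x)"
  using angle_limit[OF chord_dir_at_right[of x] tendsto_const[of "\<tau> x"]] by (simp add: out_angle_def)

lemma out_angle_at_left: "((\<lambda>y. out_angle \<xi> x y) \<longlongrightarrow> pi) (at_left (x + 1))"
  using angle_limit[OF chord_dir_at_left[of x] tendsto_const[of "\<tau> x"]] by (simp add: out_angle_def)

lemma in_angle_at_right: "((\<lambda>y. in_angle \<xi> x y) \<longlongrightarrow> 0) (at_right x)"
proof -
  have "(\<tau> \<longlongrightarrow> \<tau> x) (at_right x)"
    using continuous_velocity[of UNIV] by (simp add: continuous_on_eq_continuous_at isCont_def filterlim_at_split)
  from angle_limit[OF chord_dir_at_right[of x] this] show ?thesis by (simp add: in_angle_def)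
qed

lemma bdry_has_derivative: 
  "(X has_derivative (\<lambda>h. h *\<^sub>R \<tau> x)) (at x)" 
  using has_velocity by (simp add: has_vector_derivative_def)

lemma chord_has_derivative:
  assumes "(a has_derivative a') (at z)" "(b has_derivative b') (at z)"
  shows "((\<lambda>z. X (b z) - X (a z)) has_derivative (\<lambda>h. b' h *\<^sub>R \<tau> (b z) - a' h *\<^sub>R \<tau> (a z))) (at z)"
  by (intro has_derivative_diff has_derivative_compose[OF assms(1) bdry_has_derivative]
     has_derivative_compose[OF assms(2) bdry_has_derivative])

text \<open>
The chord length is a generating function: its differential is
\<open>cos (in_angle) dy - cos (out_angle) dx\<close>. It is stated along differentiable end points \<open>a\<close> and \<open>b\<close>,
as it is applied both to the coordinates themselves and to their images under a conjugacy.
\<close>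

lemma chord_length_has_derivative:
  assumes "(a has_derivative a') (at z)" "(b has_derivative b') (at z)" "X (a z) \<noteq> X (b z)"
  shows "((\<lambda>z. norm (X (b z) - X (a z))) has_derivative
     (\<lambda>h. b' h * (chord_dir \<xi> (a z) (b z) \<bullet> \<tau> (b z)) - a' h * (chord_dir \<xi> (a z) (b z) \<bullet> \<tau> (a z)))) (at z)"
proof -
  have "((\<lambda>z. norm (X (b z) - X (a z))) has_derivative
     (\<lambda>h. (b' h *\<^sub>R \<tau> (b z) - a' h *\<^sub>R \<tau> (a z)) \<bullet> sgn (X (b z) - X (a z)))) (at z)"
    using has_derivative_compose[OF chord_has_derivative[OF assms(1,2)] has_derivative_norm] assms(3)
    by auto
  then show ?thesis
    by (simp add: chord_dir_def inner_diff_left inner_diff_right inner_commute)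
qed

lemma angles_differentiable:
  assumes z: "z \<in> chords"
  shows "(\<lambda>z. out_angle \<xi> (fst z) (snd z)) differentiable (at z)"
    "(\<lambda>z. in_angle \<xi> (fst z) (snd z)) differentiable (at z)"
proof -
  have xy: "fst z < snd z" "snd z < fst z + 1" using z by (auto simp: chords_def)
  have arc: "arccos differentiable at t" if "\<bar>t\<bar> < 1" for t :: real
    using DERIV_arccos[of t] that unfolding real_differentiable_def abs_less_iff
    by (meson minus_less_iff)
  have comp: "(\<lambda>z. f (fst z)) differentiable at z" "(\<lambda>z. f (snd z)) differentiable at z"
    if "smooth_on f UNIV" for f :: "real \<Rightarrow> complex"
    by (rule differentiable_compose[OF smooth_on_imp_differentiable[OF that UNIV_I]],
        rule bounded_linear_imp_differentiable, rule bounded_linear_fst bounded_linear_snd)+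
  have ch: "(\<lambda>z. X (snd z) - X (fst z)) differentiable at z"
    by (intro differentiable_diff comp smooth)
  have "(\<lambda>z. norm (X (snd z) - X (fst z))) differentiable at z"
    by (rule differentiable_compose[OF differentiable_norm_at ch]) (use bdry_distinct[OF xy] in simp)
  then have cd: "(\<lambda>z. chord_dir \<xi> (fst z) (snd z)) differentiable at z"
    unfolding chord_dir_def sgn_div_norm using bdry_distinct[OF xy]
    by (intro differentiable_scaleR differentiable_inverse ch) auto
  show "(\<lambda>z. out_angle \<xi> (fst z) (snd z)) differentiable (at z)"
    unfolding out_angle_def
    by (rule differentiable_compose[where f = arccos], rule arc, rule out_angle_bounds(2)[OF xy])
      (intro differentiable_inner cd comp smooth_velocity)
  show "(\<lambda>z. in_angle \<xi> (fst z) (snd z)) differentiable (at z)"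
    unfolding in_angle_def
    by (rule differentiable_compose[where f = arccos], rule arc, rule in_angle_bounds(2)[OF xy])
      (intro differentiable_inner cd comp smooth_velocity)
qed

lemma out_angle_continuous: "continuous_on {x<..<x + 1} (out_angle \<xi> x)"
proof -
  have "continuous_on {x<..<x + 1} ((\<lambda>z. out_angle \<xi> (fst z) (snd z)) \<circ> (\<lambda>y. (x, y)))"
  proof (rule continuous_on_compose)
    show "continuous_on ((\<lambda>y. (x, y)) ` {x<..<x + 1}) (\<lambda>z. out_angle \<xi> (fst z) (snd z))"
      by (rule differentiable_imp_continuous_on)
        (auto simp: differentiable_on_def chords_def intro!: differentiable_at_withinI angles_differentiable)
  qed (auto intro!: continuous_intros)
  then show ?thesis by (simp add: o_def)
qed

text \<open>
The angle depends continuously on the end point and tends to \<open>0\<close> and \<open>\<pi>\<close> as the chord shrinks to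
\<open>x\<close> from either side; this is the existence half of the correspondence between chords and angles.
\<close>

lemma out_angle_surj:
  assumes "0 < v" "v < pi"
  obtains y where "x < y" "y < x + 1" "out_angle \<xi> x y = v"
proof -
  have "\<forall>\<^sub>F y in at_right x. out_angle \<xi> x y < v \<and> y \<in> {x<..<x + 1}"
    using order_tendstoD(2)[OF out_angle_at_right assms(1)] 
    by (intro eventually_conj eventually_at_right_real) auto
  then obtain a where a: "out_angle \<xi> x a < v" "a \<in> {x<..<x + 1}"
    using eventually_happens trivial_limit_at_right_real by blast
  have "\<forall>\<^sub>F y in at_left (x + 1). v < out_angle \<xi> x y \<and> y \<in> {x<..<x + 1}"
    using order_tendstoD(1)[OF out_angle_at_left assms(2)] 
    by (intro eventually_conj eventually_at_left_real) auto
  then obtain b where b: "v < out_angle \<xi> x b" "b \<in> {x<..<x + 1}"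
    using eventually_happens trivial_limit_at_left_real by blast
  have "connected (out_angle \<xi> x ` {x<..<x + 1})"
    by (intro connected_continuous_image out_angle_continuous) simp
  then have "v \<in> out_angle \<xi> x ` {x<..<x + 1}"
    using connectedD_interval[of "out_angle \<xi> x ` {x<..<x + 1}" "out_angle \<xi> x a" "out_angle \<xi> x b" v] a b by auto
  then show thesis using that by auto
qed

end

section \<open>Length-maximizing configurations are billiard orbits\<close>

definition action :: "(circle \<Rightarrow> complex) \<Rightarrow> nat \<Rightarrow> (nat \<Rightarrow> real) \<Rightarrow> real" where
  "action \<xi> q x = (\<Sum>i<q. h_fun \<xi> (x i) (x (Suc i)))"

lemma h_fun_bdry: "h_fun \<xi> x y = - norm (bdry \<xi> y - bdry \<xi> x)"
  by (simp add: h_fun_def bdry_def norm_minus_commute)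

lemma action_cong: "(\<And>i. i \<le> q \<Longrightarrow> x i = y i) \<Longrightarrow> action \<xi> q x = action \<xi> q y"
  unfolding action_def by (intro sum.cong) auto

lemma configs_cong:
  assumes "\<And>i. i \<le> q \<Longrightarrow> x i = y i"
  shows "x \<in> configs s p q \<longleftrightarrow> y \<in> configs s p q"
proof -
  have "x i = y i \<and> x (Suc i) = y (Suc i)" if "i < q" for i using assms that by auto
  with assms show ?thesis unfolding configs_def by simp
qed

lemma configs_bounds:
  assumes "x \<in> configs s p q" "i \<le> q"
  shows "x i \<in> {s..s + real q}"
proof -
  have "s \<le> x i \<and> x i \<le> s + real i" using assms(2)
  proof (induction i)
    case 0 with assms show ?case by (simp add: configs_def)
  next
    case (Suc i)
    then have "x i \<le> x (Suc i)" "x (Suc i) \<le> x i + 1" "s \<le> x i" "x i \<le> s + real i"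
      using assms(1) by (auto simp: configs_def)
    then show ?case by auto
  qed
  with assms(2) show ?thesis by auto
qed

lemma configs_nonempty: "p \<le> q \<Longrightarrow> (\<lambda>i. s + real (min i p)) \<in> configs s p q"
  by (auto simp: configs_def min_def)

lemma configs_translate:
  assumes "x \<in> configs s p q" shows "(\<lambda>i. x i + c) \<in> configs (s + c) p q"
  using assms by (auto simp: configs_def algebra_simps)

text \<open>
Tychonoff; configurations live in the product space of sequences.
\<close>

lemma compact_box_fun:
  fixes a b :: "nat \<Rightarrow> real"
  shows "compact {x. \<forall>i. x i \<in> {a i..b i}}"
proof -
  have "compactin (product_topology (\<lambda>i. euclidean) UNIV) (PiE UNIV (\<lambda>i. {a i..b i}))"
    by (subst compactin_PiE) auto
  moreover have "PiE UNIV (\<lambda>i. {a i..b i}) = {x. \<forall>i. x i \<in> {a i..b i}}"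
    by (auto simp: PiE_def Pi_def)
  ultimately show ?thesis by (simp add: euclidean_product_topology)
qed

context table begin

lemma action_add_Ints:
  assumes "n \<in> \<int>" shows "action \<xi> q (\<lambda>i. x i + n) = action \<xi> q x"
  using assms by (simp add: action_def h_fun_bdry)

text \<open>
The set \<open>T\<close> is a single point for the inner minimum in the definition of the beta function and the
unit interval for the joint minimum.
\<close>

lemma exists_minimal_config:
  assumes pq: "p \<le> q" and T: "compact T" "T \<noteq> {}"
  obtains x s where "s \<in> T" "x \<in> configs s p q"
    "\<And>y t. t \<in> T \<Longrightarrow> y \<in> configs t p q \<Longrightarrow> action \<xi> q x \<le> action \<xi> q y"
proof -
  obtain a b where ab: "T \<subseteq> {a..b}"
    using bounded_subset_cbox_symmetric[OF compact_imp_bounded[OF T(1)]] by (metis cbox_interval)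
  \<comment> \<open>The box confines all entries, also those after the \<open>q\<close>-th, which makes \<open>K\<close> compact; truncation
    brings every configuration into \<open>K\<close> without changing its action.\<close>
  define K where "K = {x. x 0 \<in> T \<and> x \<in> configs (x 0) p q} \<inter> {x::nat \<Rightarrow> real. \<forall>i. x i \<in> {a..b + real q}}"
  have "closed {x::nat \<Rightarrow> real. x 0 \<in> T}"
    using continuous_on_closed_vimage[of UNIV "\<lambda>x::nat \<Rightarrow> real. x 0"] T(1)
      continuous_on_product_coordinates[of 0]
    by (simp add: vimage_def compact_imp_closed)
  moreover have "closed {x::nat \<Rightarrow> real. x \<in> configs (x 0) p q}"
    unfolding configs_def
    by (simp, intro closed_Collect_conj closed_Collect_eq closed_Collect_all closed_Collect_imp
        closed_Collect_le continuous_intros continuous_on_product_coordinates) auto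
  ultimately have "compact K"
    unfolding K_def by (intro compact_box_fun closed_Int_compact) (simp add: Collect_conj_eq closed_Int)
  moreover have "continuous_on K (action \<xi> q)"
    unfolding action_def h_fun_bdry
    by (intro continuous_intros continuous_on_compose2[OF continuous_bdry[of UNIV]]
        continuous_on_product_coordinates[THEN continuous_on_subset]) auto
  moreover have trunc: "(\<lambda>i. if i \<le> q then y i else t) \<in> K" if "t \<in> T" "y \<in> configs t p q" for y t
  proof -
    have "y 0 = t" using that by (simp add: configs_def)
    moreover have "(\<lambda>i. if i \<le> q then y i else t) \<in> configs t p q"
      using configs_cong[of q "\<lambda>i. if i \<le> q then y i else t" y t p] that by simp
    moreover have "t \<in> {a..b}" using ab that by auto
    ultimately show ?thesis
      unfolding K_def using configs_bounds[OF that(2)] that(1) by force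
  qed
  moreover have "K \<noteq> {}" using trunc configs_nonempty[OF pq] T(2) by blast
  ultimately obtain x where x: "x \<in> K" "\<And>y. y \<in> K \<Longrightarrow> action \<xi> q x \<le> action \<xi> q y"
    using continuous_attains_inf[of K "action \<xi> q"] by blast
  show thesis
  proof
    show "x 0 \<in> T" "x \<in> configs (x 0) p q" using x(1) by (auto simp: K_def)
    fix y t assume "t \<in> T" "y \<in> configs t p q"
    from x(2)[OF trunc[OF this]] show "action \<xi> q x \<le> action \<xi> q y"
      using action_cong[of q "\<lambda>i. if i \<le> q then y i else t" y] by simp
  qed
qed

lemma min_action_eqI:
  assumes "x \<in> configs s p q" "\<And>y. y \<in> configs s p q \<Longrightarrow> action \<xi> q x \<le> action \<xi> q y"
  shows "min_action \<xi> s p q = action \<xi> q x"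
  unfolding min_action_def using assms by (intro Least_equality) (auto simp: action_def)

text \<open>
The nested minimum is the minimum over all configurations, with arbitrary real starting point since
integer translations preserve the action.
\<close>

lemma beta_frac_minimum:
  assumes "p \<le> q" "q > 0"
  obtains x s where "x \<in> configs s p q" "real q * beta_frac \<xi> p q = action \<xi> q x"
    "\<And>y t. y \<in> configs t p q \<Longrightarrow> action \<xi> q x \<le> action \<xi> q y"
proof -
  obtain x s where s: "s \<in> {0..1}" and x: "x \<in> configs s p q"
    and min: "\<And>y t. t \<in> {0..1} \<Longrightarrow> y \<in> configs t p q \<Longrightarrow> action \<xi> q x \<le> action \<xi> q y"
    by (rule exists_minimal_config[OF assms(1) compact_Icc[of 0 1]]) (simp, blast)
  have min': "action \<xi> q x \<le> action \<xi> q y" if "y \<in> configs t p q" for y t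
  proof -
    let ?c = "- of_int \<lfloor>t\<rfloor> :: real"
    have "t + ?c \<in> {0..1}" by (auto; linarith)
    from min[OF this configs_translate[OF that]] show ?thesis by (simp only: action_add_Ints[OF Ints_minus[OF Ints_of_int]])
  qed
  have ms: "action \<xi> q x \<le> min_action \<xi> t p q" for t
  proof -
    obtain y t' where "t' \<in> {t}" "y \<in> configs t' p q" "\<And>z u. u \<in> {t} \<Longrightarrow> z \<in> configs u p q \<Longrightarrow> action \<xi> q y \<le> action \<xi> q z"
      by (rule exists_minimal_config[OF assms(1), of "{t}"]) (simp, simp, blast)
    then show ?thesis using min_action_eqI[of y t p q] min' by auto
  qed
  have "min_action \<xi> s p q = action \<xi> q x" using min' x by (intro min_action_eqI) auto
  then have "(LEAST b. b \<in> (\<lambda>s. min_action \<xi> s p q) ` {0..1}) = action \<xi> q x"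
    using s ms by (intro Least_equality) force+
  then have "real q * beta_frac \<xi> p q = action \<xi> q x" using assms(2) by (simp add: beta_frac_def)
  with x min' that show thesis by blast
qed

lemma detour_longer:
  assumes "x < y" "y < x + 1" "y < z" "z < y + 1"
  shows "norm (X z - X x) < norm (X y - X x) + norm (X z - X y)"
proof -
  have ne: "X y \<noteq> X x" "X z \<noteq> X y" using bdry_distinct assms by auto
  have "\<not> between (X x, X z) (X y)"
    using not_between[of y x z] ne by (auto simp: between_mem_segment open_segment_def)
  then have "norm (X x - X z) \<noteq> norm (X x - X y) + norm (X y - X z)"
    by (simp add: between dist_norm)
  moreover have "norm (X x - X z) \<le> norm (X x - X y) + norm (X y - X z)"
    using norm_triangle_ineq[of "X x - X y" "X y - X z"] by simp
  ultimately show ?thesis by (simp add: norm_minus_commute)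
qed

text \<open>
If a point between \<open>x\<close> and \<open>z\<close> maximizes the length of the two chords, then it obeys the reflection
law, which is the vanishing of the derivative. A degenerate chord is excluded beforehand: the two
chords would then be no longer than the direct one, and any genuine intermediate point beats that by
the strict triangle inequality.
\<close>

lemma optimal_bounce:
  assumes steps: "x \<le> y" "y \<le> x + 1" "y \<le> z" "z \<le> y + 1" and "x < z" "z < x + 2"
    and opt: "\<And>t. x \<le> t \<Longrightarrow> t \<le> x + 1 \<Longrightarrow> t \<le> z \<Longrightarrow> z \<le> t + 1 \<Longrightarrow>
      norm (X t - X x) + norm (X z - X t) \<le> norm (X y - X x) + norm (X z - X y)"
  shows "x < y \<and> y < x + 1 \<and> y < z \<and> z < y + 1" "in_angle \<xi> x y = out_angle \<xi> y z"
proof -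
  show strict: "x < y \<and> y < x + 1 \<and> y < z \<and> z < y + 1"
  proof (rule ccontr)
    assume "\<not> ?thesis"
    with steps have "y = x \<or> y = x + 1 \<or> z = y \<or> z = y + 1" by auto
    then have "norm (X y - X x) + norm (X z - X y) = norm (X z - X x)" by auto
    \<comment> \<open>The centre of the interval of points at parameter distance less than \<open>1\<close> from both
      neighbours; it is nonempty because \<open>x < z < x + 2\<close>.\<close>
    moreover define t where "t = (max x (z - 1) + min (x + 1) z) / 2"
    have "x < t" "t < x + 1" "t < z" "z < t + 1"
      using assms(5,6) unfolding t_def by (auto simp: max_def min_def field_simps)
    ultimately show False using opt[of t] detour_longer[of x t z] by auto
  qed
  define L where "L t = norm (X t - X x) + norm (X z - X t)" for t
  have ne: "X x \<noteq> X y" "X y \<noteq> X z" using bdry_distinct strict by metis+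
  have "(L has_derivative (\<lambda>h. h * (chord_dir \<xi> x y \<bullet> \<tau> y) - h * (chord_dir \<xi> y z \<bullet> \<tau> y))) (at y)"
    unfolding L_def
    using has_derivative_add[OF
        chord_length_has_derivative[OF has_derivative_const[of x] has_derivative_ident, of y]
        chord_length_has_derivative[OF has_derivative_ident has_derivative_const[of z], of y]] ne
    by simp
  then have "(L has_real_derivative (chord_dir \<xi> x y \<bullet> \<tau> y - chord_dir \<xi> y z \<bullet> \<tau> y)) (at y)"
    unfolding has_field_derivative_def by (rule has_derivative_eq_rhs) (auto simp: algebra_simps)
  moreover define d where "d = min (min (y - x) (x + 1 - y)) (min (z - y) (y + 1 - z))"
  have "d > 0" using strict by (simp add: d_def)
  moreover have "\<forall>t. \<bar>y - t\<bar> < d \<longrightarrow> L t \<le> L y"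
    unfolding L_def d_def by (intro allI impI opt) auto
  ultimately have "chord_dir \<xi> x y \<bullet> \<tau> y - chord_dir \<xi> y z \<bullet> \<tau> y = 0"
    using DERIV_local_max by blast
  then show "in_angle \<xi> x y = out_angle \<xi> y z" by (simp add: in_angle_def out_angle_def)
qed

end

text \<open>
Billiard orbits are written as sequences of boundary parameters on the universal cover, so that the
rotation number of a closed orbit is the translation \<open>p\<close> over one period.
\<close>

definition billiard_seq :: "(circle \<Rightarrow> complex) \<Rightarrow> (nat \<Rightarrow> real) \<Rightarrow> bool" where
  "billiard_seq \<xi> x \<longleftrightarrow> (\<forall>i. x i < x (Suc i) \<and> x (Suc i) < x i + 1 \<and>
     in_angle \<xi> (x i) (x (Suc i)) = out_angle \<xi> (x (Suc i)) (x (Suc (Suc i))))"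

definition closed_seq :: "(circle \<Rightarrow> complex) \<Rightarrow> int \<Rightarrow> nat \<Rightarrow> (nat \<Rightarrow> real) \<Rightarrow> bool" where
  "closed_seq \<xi> p q x \<longleftrightarrow> billiard_seq \<xi> x \<and> (\<forall>i. x (i + q) = x i + of_int p)"

lemma periodic_sum_shift:
  fixes a :: "nat \<Rightarrow> 'a::ab_group_add"
  assumes "\<And>i. a (i + q) = a i" shows "(\<Sum>i<q. a (i + j)) = (\<Sum>i<q. a i)"
proof (induction j)
  case (Suc j)
  have "(\<Sum>i<q. a (Suc i + j)) - (\<Sum>i<q. a (i + j)) = a (q + j) - a (0 + j)"
    using sum_lessThan_telescope[of "\<lambda>i. a (i + j)" q] by (simp add: sum_subtractf)
  with Suc assms[of j] show ?case by (simp add: add.commute)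
qed simp

context table begin

text \<open>
Extending a configuration quasi-periodically turns its two end points into an ordinary bounce.
\<close>

lemma config_periodic_extension:
  assumes x: "x \<in> configs s p q" and q: "q > 0"
  obtains y where "\<And>i. i \<le> q \<Longrightarrow> y i = x i" "\<And>i. y (i + q) = y i + real p"
    "\<And>i. y i \<le> y (Suc i)" "\<And>i. y (Suc i) \<le> y i + 1"
proof -
  define y where "y i = x (i mod q) + real p * real (i div q)" for i
  have xq: "x q = x 0 + real p" using x by (simp add: configs_def)
  have yx: "y i = x i" if "i \<le> q" for i
    using that xq q by (cases "i = q") (auto simp: y_def)
  have per: "y (i + q) = y i + real p" for i
    using q by (simp add: y_def algebra_simps)
  have perk: "y (i + k * q) = y i + real k * real p" for i k
  proof (induction k)
    case (Suc k)
    have "y (i + Suc k * q) = y ((i + k * q) + q)" by (simp add: algebra_simps)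
    with Suc per[of "i + k * q"] show ?case by (simp add: algebra_simps)
  qed simp
  have step: "y i \<le> y (Suc i) \<and> y (Suc i) \<le> y i + 1" for i
  proof -
    have "y i = y (i mod q) + real (i div q) * real p" "y (Suc i) = y (Suc (i mod q)) + real (i div q) * real p"
      using perk[of "i mod q" "i div q"] perk[of "Suc (i mod q)" "i div q"] by simp_all
    moreover have "i mod q < q" using q by simp
    ultimately show ?thesis using x yx[of "i mod q"] yx[of "Suc (i mod q)"] by (simp add: configs_def)
  qed
  show thesis using that[of y] yx per step by blast
qed

text \<open>
Every consecutive triple of a minimizer is optimal in the sense of \<open>optimal_bounce\<close>. Degenerate
steps cannot occur: a degenerate step can only stand next to a step of the same kind, so that all steps
would be \<open>0\<close>, or all would be \<open>1\<close>, against \<open>0 < p < q\<close>.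
\<close>

lemma minimal_config_closed_seq:
  assumes x: "x \<in> configs s p q" and pq: "0 < p" "p < q"
    and min: "\<And>y t. y \<in> configs t p q \<Longrightarrow> action \<xi> q x \<le> action \<xi> q y"
  obtains y where "closed_seq \<xi> (int p) q y" "action \<xi> q y = action \<xi> q x"
proof -
  obtain y where yx: "\<And>i. i \<le> q \<Longrightarrow> y i = x i" and per: "\<And>i. y (i + q) = y i + real p"
    and step: "\<And>i. y i \<le> y (Suc i)" "\<And>i. y (Suc i) \<le> y i + 1"
    using config_periodic_extension[OF x] pq by auto
  have Ayx: "action \<xi> q y = action \<xi> q x" using yx by (rule action_cong)
  have shift: "action \<xi> q (\<lambda>i. y (i + j)) = action \<xi> q y" for j
    using periodic_sum_shift[of "\<lambda>i. h_fun \<xi> (y i) (y (Suc i))" q j] per[of "Suc _"] per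
    by (simp add: action_def h_fun_bdry)
  \<comment> \<open>Starting the period at \<open>y j\<close> makes \<open>y (j + 1)\<close> the first interior entry, which can be moved
    without touching the end points.\<close>
  have opt: "norm (X t - X (y j)) + norm (X (y (j + 2)) - X t)
     \<le> norm (X (y (j + 1)) - X (y j)) + norm (X (y (j + 2)) - X (y (j + 1)))"
    if t: "y j \<le> t" "t \<le> y j + 1" "t \<le> y (j + 2)" "y (j + 2) \<le> t + 1" for j t
  proof -
    define w where "w = (\<lambda>i. y (i + j))(1 := t)"
    obtain r where r: "q = Suc (Suc r)" using pq by (metis Suc_lessE Suc_lessI gr0_implies_Suc less_trans_Suc not_less_eq)
    have "w \<in> configs (y j) p q"
      unfolding configs_def using t step per[of j] pq by (auto simp: w_def add.commute eval_nat_numeral)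
    then have "action \<xi> q y \<le> action \<xi> q w" using min Ayx by simp
    then have "action \<xi> q (\<lambda>i. y (i + j)) \<le> action \<xi> q w" using shift by simp
    then show ?thesis
      unfolding r action_def by (simp add: sum.lessThan_Suc_shift w_def h_fun_bdry del: sum.lessThan_Suc)
  qed
  define a where "a i = y (Suc i) - y i" for i
  have pair: "(0 < a j \<and> a j < 1) \<and> in_angle \<xi> (y j) (y (j + 1)) = out_angle \<xi> (y (j + 1)) (y (j + 2))"
    if "0 < a j + a (Suc j)" "a j + a (Suc j) < 2" for j
    using optimal_bounce[of "y j" "y (j + 1)" "y (j + 2)"] step[of j] step[of "Suc j"] opt[of j] that
    by (auto simp: a_def)
  have a01: "0 \<le> a i" "a i \<le> 1" for i using step[of i] by (auto simp: a_def)
  have suma: "(\<Sum>i<q. a i) = real p"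
    using sum_lessThan_telescope[of y q] per[of 0] by (simp add: a_def)
  have good: "0 < a j + a (Suc j) \<and> a j + a (Suc j) < 2" for j
  proof (rule ccontr)
    assume bad: "\<not> ?thesis"
    have "\<exists>c\<in>{0,1}. \<forall>i. a (j + i) = c"
    proof -
      define c where "c = a j"
      have c: "c \<in> {0,1}" using bad a01[of j] a01[of "Suc j"] by (auto simp: c_def)
      have "a (j + i) = c" for i
      proof (induction i)
        case (Suc i)
        have "\<not> (0 < a (j + i) + a (Suc (j + i)) \<and> a (j + i) + a (Suc (j + i)) < 2)"
          using pair[of "j + i"] Suc c by auto
        then show ?case using Suc c a01[of "j + i"] a01[of "Suc (j + i)"] by auto
      qed (simp add: c_def)
      with c show ?thesis by blast
    qed
    then obtain c where "c \<in> {0, 1}" "\<And>i. a (j + i) = c" by blast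
    moreover have "(\<Sum>i<q. a (i + j)) = real p"
      using periodic_sum_shift[of a q j] per[of "Suc _"] per suma by (simp add: a_def)
    ultimately have "real q * c = real p" by (simp add: add.commute)
    with \<open>c \<in> {0, 1}\<close> pq show False by auto
  qed
  have "closed_seq \<xi> (int p) q y"
    unfolding closed_seq_def billiard_seq_def using pair[OF good[THEN conjunct1] good[THEN conjunct2]] per
    by (auto simp: a_def algebra_simps)
  then show thesis using that Ayx by blast
qed

lemma closed_seq_config:
  assumes "closed_seq \<xi> p q x" "p = int n" shows "x \<in> configs (x 0) n q"
  using assms by (auto simp: closed_seq_def billiard_seq_def configs_def intro: less_imp_le)
    (metis add_0)+

lemma closed_seq_rotation_bounds:
  assumes x: "closed_seq \<xi> p q x" and q: "q > 0"
  shows "0 < p" "p < int q"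
proof -
  have x': "x i < x (Suc i)" "x (Suc i) < x i + 1" for i
    using x by (auto simp: closed_seq_def billiard_seq_def)
  have "(\<Sum>i<q. x (Suc i) - x i) = of_int p"
    using sum_lessThan_telescope[of x q] x by (simp add: closed_seq_def)
      (metis add_0 add_diff_cancel_left')
  moreover have "(\<Sum>i<q. 0) < (\<Sum>i<q. x (Suc i) - x i)"
    by (rule sum_strict_mono) (use x'(1) q in auto)
  moreover have "(\<Sum>i<q. x (Suc i) - x i) < (\<Sum>i<q. 1)"
    by (rule sum_strict_mono) (use x'(2) q in \<open>auto simp: less_diff_eq diff_less_eq add.commute\<close>)
  ultimately have "0 < real_of_int p" "real_of_int p < real q" by auto
  then show "0 < p" "p < int q" by linarith+
qed

lemma beta_frac_attained:
  assumes "0 < p" "p < q"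
  obtains x where "closed_seq \<xi> (int p) q x" "action \<xi> q x = real q * beta_frac \<xi> p q"
proof -
  obtain x s where "x \<in> configs s p q" "real q * beta_frac \<xi> p q = action \<xi> q x"
    "\<And>y t. y \<in> configs t p q \<Longrightarrow> action \<xi> q x \<le> action \<xi> q y"
    by (rule beta_frac_minimum[of p q]) (use assms in auto)
  then show thesis using minimal_config_closed_seq[of x s p q] assms that by metis
qed

lemma beta_frac_le_action:
  assumes "0 < p" "p < q" "x \<in> configs s p q"
  shows "real q * beta_frac \<xi> p q \<le> action \<xi> q x"
proof -
  obtain y u where "real q * beta_frac \<xi> p q = action \<xi> q y"
    "\<And>z t. z \<in> configs t p q \<Longrightarrow> action \<xi> q y \<le> action \<xi> q z"
    by (rule beta_frac_minimum[of p q]) (use assms in auto)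
  with assms(3) show ?thesis by simp
qed

text \<open>
Traversing a configuration backwards turns a step \<open>a\<close> into \<open>-a\<close>, which the complementary arc
\<open>1 - a\<close> represents. Adding \<open>1\<close> at every step exchanges rotation \<open>p\<close> and \<open>q - p\<close>.
\<close>

lemma reversed_config:
  assumes x: "x \<in> configs s p q" and pq: "p \<le> q"
  shows "(\<lambda>i. x (q - i) + real i) \<in> configs (s + real p) (q - p) q"
    "action \<xi> q (\<lambda>i. x (q - i) + real i) = action \<xi> q x"
proof -
  have "x (q - Suc i) \<le> x (q - i) \<and> x (q - i) \<le> x (q - Suc i) + 1" if "i < q" for i
  proof -
    have "q - i = Suc (q - Suc i)" using that by simp
    moreover have "q - Suc i < q" using that by simp
    ultimately show ?thesis using x unfolding configs_def by (metis (mono_tags, lifting) mem_Collect_eq)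
  qed
  then show "(\<lambda>i. x (q - i) + real i) \<in> configs (s + real p) (q - p) q"
    using x pq by (auto simp: configs_def of_nat_diff algebra_simps)
  have "action \<xi> q (\<lambda>i. x (q - i) + real i) = (\<Sum>i<q. h_fun \<xi> (x (q - i)) (x (q - Suc i)))"
  proof -
    have "h_fun \<xi> (x (q - i) + real i) (x (q - Suc i) + real (Suc i)) = h_fun \<xi> (x (q - i)) (x (q - Suc i))" for i
      unfolding h_fun_bdry by (subst (1 2) bdry_add_Ints) (auto simp del: of_nat_Suc)
    then show ?thesis by (simp add: action_def del: of_nat_Suc)
  qed
  also have "\<dots> = (\<Sum>i<q. h_fun \<xi> (x (q - Suc i)) (x (Suc (q - Suc i))))"
  proof (rule sum.cong)
    fix i assume "i \<in> {..<q}"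
    then have "q - i = Suc (q - Suc i)" by auto
    then show "h_fun \<xi> (x (q - i)) (x (q - Suc i)) = h_fun \<xi> (x (q - Suc i)) (x (Suc (q - Suc i)))"
      by (simp add: h_fun_def norm_minus_commute)
  qed simp
  also have "\<dots> = action \<xi> q x"
    unfolding action_def by (rule sum.nat_diff_reindex)
  finally show "action \<xi> q (\<lambda>i. x (q - i) + real i) = action \<xi> q x" .
qed

lemma beta_frac_reverse:
  assumes pq: "0 < p" "p < q"
  shows "beta_frac \<xi> (q - p) q = beta_frac \<xi> p q"
proof -
  have le: "real q * beta_frac \<xi> (q - r) q \<le> real q * beta_frac \<xi> r q" if r: "0 < r" "r < q" for r
  proof -
    obtain x s where "x \<in> configs s r q" "real q * beta_frac \<xi> r q = action \<xi> q x"
      by (rule beta_frac_minimum[of r q]) (use r in auto)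
    then show ?thesis
      using beta_frac_le_action[OF _ _ reversed_config(1)[of x s r q]] reversed_config(2)[of x s r q] r
      by auto
  qed
  have "real q * beta_frac \<xi> (q - p) q = real q * beta_frac \<xi> p q"
    using le[of p] le[of "q - p"] pq by auto
  then show ?thesis using pq by simp
qed

section \<open>Orbits determined by initial data\<close>


lemma interior_point_on_chord:
  assumes "0 < snd z" "snd z < pi"
  obtains x y where "x < y" "y < x + 1" "z = annulus_proj (x, out_angle \<xi> x y)"
proof -
  obtain y where "rep_circle (fst z) < y" "y < rep_circle (fst z) + 1" "out_angle \<xi> (rep_circle (fst z)) y = snd z"
    using out_angle_surj[OF assms] by blast
  then show thesis using that by (metis annulus_proj_rep_circle)
qed

lemma billiard_map_in_annulus: "z \<in> annulus \<Longrightarrow> billiard_map \<xi> z \<in> annulus"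
proof (cases "0 < snd z \<and> snd z < pi")
  case True
  then obtain x y where xy: "x < y" "y < x + 1" "z = annulus_proj (x, out_angle \<xi> x y)"
    using interior_point_on_chord by blast
  then show ?thesis using billiard_map_chord[OF xy(1,2)] in_angle_bounds(1)[OF xy(1,2)]
    by (simp add: strip_def)
qed (auto simp: billiard_map_def)

text \<open>
This dynamical description of the boundary circles is what makes a conjugacy respect them.
\<close>

lemma billiard_map_fixed_iff: "billiard_map \<xi> z = z \<longleftrightarrow> \<not> (0 < snd z \<and> snd z < pi)"
proof (cases "0 < snd z \<and> snd z < pi")
  case True
  then obtain x y where xy: "x < y" "y < x + 1" "z = annulus_proj (x, out_angle \<xi> x y)"
    using interior_point_on_chord by blast
  have "circle_of x \<noteq> circle_of y" using bdry_distinct[OF xy(1,2)] by (auto simp: bdry_def)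
  then show ?thesis using billiard_map_chord[OF xy(1,2)] True xy(3)
    by (metis annulus_proj_def fst_conv)
qed (auto simp: billiard_map_def)

lemma billiard_seq_exists:
  assumes "0 < v" "v < pi"
  obtains x where "billiard_seq \<xi> x" "x 0 = s" "out_angle \<xi> s (x 1) = v"
proof -
  have "\<exists>f. \<forall>n. (0 < snd (f n) \<and> snd (f n) < pi \<and> (n = 0 \<longrightarrow> f n = (s, v))) \<and>
     (fst (f n) < fst (f (Suc n)) \<and> fst (f (Suc n)) < fst (f n) + 1 \<and>
        out_angle \<xi> (fst (f n)) (fst (f (Suc n))) = snd (f n) \<and>
        in_angle \<xi> (fst (f n)) (fst (f (Suc n))) = snd (f (Suc n)))"
  proof (rule dependent_nat_choice[where P = "\<lambda>n w. 0 < snd w \<and> snd w < pi \<and> (n = 0 \<longrightarrow> w = (s, v))"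
        and Q = "\<lambda>n w w'. fst w < fst w' \<and> fst w' < fst w + 1 \<and>
          out_angle \<xi> (fst w) (fst w') = snd w \<and> in_angle \<xi> (fst w) (fst w') = snd w'"])
    show "\<exists>w. 0 < snd w \<and> snd w < pi \<and> (0 = (0::nat) \<longrightarrow> w = (s, v))" using assms by auto
    fix w :: "real \<times> real" and n :: nat
    assume w: "0 < snd w \<and> snd w < pi \<and> (n = 0 \<longrightarrow> w = (s, v))"
    obtain y where y: "fst w < y" "y < fst w + 1" "out_angle \<xi> (fst w) y = snd w"
      by (rule out_angle_surj[of "snd w" "fst w"]) (use w in auto)
    then show "\<exists>w'. (0 < snd w' \<and> snd w' < pi \<and> (Suc n = 0 \<longrightarrow> w' = (s, v))) \<and>
       fst w < fst w' \<and> fst w' < fst w + 1 \<and>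
       out_angle \<xi> (fst w) (fst w') = snd w \<and> in_angle \<xi> (fst w) (fst w') = snd w'"
      using in_angle_bounds(1)[OF y(1,2)] by (intro exI[of _ "(y, in_angle \<xi> (fst w) y)"]) auto
  qed
  then obtain f where f0: "f 0 = (s, v)" and
     f: "\<And>n. fst (f n) < fst (f (Suc n)) \<and> fst (f (Suc n)) < fst (f n) + 1 \<and>
        out_angle \<xi> (fst (f n)) (fst (f (Suc n))) = snd (f n) \<and>
        in_angle \<xi> (fst (f n)) (fst (f (Suc n))) = snd (f (Suc n))" by auto
  have "billiard_seq \<xi> (\<lambda>n. fst (f n))" unfolding billiard_seq_def using f by metis
  then show thesis using that[of "\<lambda>n. fst (f n)"] f0 f[of 0] by simp
qed

text \<open>
An orbit is determined by its first bounce, and translating the cover by an integer commutes with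
the dynamics.
\<close>

lemma billiard_seq_rigid:
  assumes x: "billiard_seq \<xi> x" and y: "billiard_seq \<xi> y"
    and n: "n \<in> \<int>" and init: "y 0 = x 0 + n" "out_angle \<xi> (y 0) (y 1) = out_angle \<xi> (x 0) (x 1)"
  shows "y i = x i + n"
proof -
  have xs: "x i < x (Suc i)" "x (Suc i) < x i + 1"
    "in_angle \<xi> (x i) (x (Suc i)) = out_angle \<xi> (x (Suc i)) (x (Suc (Suc i)))" for i
    using x by (auto simp: billiard_seq_def)
  have ys: "y i < y (Suc i)" "y (Suc i) < y i + 1"
    "in_angle \<xi> (y i) (y (Suc i)) = out_angle \<xi> (y (Suc i)) (y (Suc (Suc i)))" for i
    using y by (auto simp: billiard_seq_def)
  have "y i = x i + n \<and> out_angle \<xi> (y i) (y (Suc i)) = out_angle \<xi> (x i) (x (Suc i))"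
  proof (induction i)
    case (Suc i)
    have "y (Suc i) = x (Suc i) + n"
      by (rule out_angle_inj[of "y i"]) (use xs[of i] ys[of i] Suc n in auto)
    then show ?case using Suc xs(3)[of i] ys(3)[of i] n by (metis angle_add_Ints(2))
  qed (use init in simp)
  then show ?thesis ..
qed

end

section \<open>Lifting the conjugacy to the strip\<close>

lemma continuous_on_locally:
  fixes f :: "'a::t2_space \<Rightarrow> 'b::topological_space"
  assumes "\<And>z. z \<in> S \<Longrightarrow> \<exists>U. open U \<and> z \<in> U \<and> continuous_on (U \<inter> S) f"
  shows "continuous_on S f"
  unfolding continuous_on_eq_continuous_within
proof (rule ballI)
  fix z assume z: "z \<in> S"
  then obtain U where U: "open U" "z \<in> U" "continuous_on (U \<inter> S) f" using assms by blast
  then have "continuous (at z within (U \<inter> S)) f" using z by (simp add: continuous_on_eq_continuous_within)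
  moreover have "at z within (U \<inter> S) = at z within S"
    using U by (intro at_within_nhd[of z U]) auto
  ultimately show "continuous (at z within S) f" by simp
qed

lemma convex_strip: "convex strip"
  unfolding strip_def by (intro convex_Times) auto

lemma Ints_valued_constant:
  fixes f :: "'a::real_normed_vector \<Rightarrow> real"
  assumes "connected S" "continuous_on S f" "\<And>z. z \<in> S \<Longrightarrow> f z \<in> \<int>"
  obtains m :: int where "\<And>z. z \<in> S \<Longrightarrow> f z = of_int m"
proof (cases "S = {}")
  case False
  have "f constant_on S"
  proof (rule continuous_discrete_range_constant[OF assms(1,2)])
    fix z assume z: "z \<in> S"
    have "1 \<le> norm (f w - f z)" if "w \<in> S" "f w \<noteq> f z" for w
      using Ints_nonzero_abs_ge1[of "f w - f z"] assms(3)[OF z] assms(3)[OF that(1)] that(2) by simp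
    then show "\<exists>e>0. \<forall>w. w \<in> S \<and> f w \<noteq> f z \<longrightarrow> e \<le> norm (f w - f z)"
      by (intro exI[of _ 1]) auto
  qed
  then obtain c where c: "\<And>z. z \<in> S \<Longrightarrow> f z = c" by (auto simp: constant_on_def)
  with False assms(3) have "c \<in> \<int>" by force
  then show thesis using c that by (auto elim: Ints_cases)
qed (use that in auto)

text \<open>
By the intermediate value theorem a continuous function that misses the integers cannot cross one.
\<close>

lemma floor_constant:
  fixes f :: "'a::real_normed_vector \<Rightarrow> real"
  assumes "connected S" "continuous_on S f" "\<And>z. z \<in> S \<Longrightarrow> f z \<notin> \<int>"
  obtains k :: int where "\<And>z. z \<in> S \<Longrightarrow> of_int k < f z \<and> f z < of_int k + 1"
proof -
  have le: "\<lfloor>f z\<rfloor> \<le> \<lfloor>f w\<rfloor>" if "z \<in> S" "w \<in> S" for z w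
  proof (rule ccontr)
    assume "\<not> ?thesis"
    then have "f w \<le> of_int \<lfloor>f z\<rfloor>" "of_int \<lfloor>f z\<rfloor> \<le> f z" by linarith+
    moreover have "connected (f ` S)" using assms by (intro connected_continuous_image)
    ultimately have "of_int \<lfloor>f z\<rfloor> \<in> f ` S"
      using that connectedD_interval[of "f ` S" "f w" "f z"] by auto
    with assms(3) show False by (metis Ints_of_int imageE)
  qed
  show thesis
  proof (cases "S = {}")
    case False
    then obtain z where z: "z \<in> S" by blast
    show thesis
    proof (rule that)
      fix w assume w: "w \<in> S"
      have "\<lfloor>f z\<rfloor> = \<lfloor>f w\<rfloor>" using le w z by (simp add: order_antisym)
      moreover have "of_int \<lfloor>f w\<rfloor> \<noteq> f w" using assms(3)[OF w] by (metis Ints_of_int)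
      ultimately show "of_int \<lfloor>f z\<rfloor> < f w \<and> f w < of_int \<lfloor>f z\<rfloor> + 1" by linarith
    qed
  qed (use that in auto)
qed

text \<open>
Continuity of a map of the annulus means continuity in the coordinates of the strip, that is,
continuity of a lift.
\<close>

definition is_lift :: "(circle \<times> real \<Rightarrow> circle \<times> real) \<Rightarrow> (real \<times> real \<Rightarrow> real \<times> real) \<Rightarrow> bool" where
  "is_lift \<Phi> F \<longleftrightarrow> continuous_on strip F \<and> (\<forall>z\<in>strip. annulus_proj (F z) = \<Phi> (annulus_proj z))"

text \<open>
Continuity of a map of the annulus, tested against functions that are continuous in the coordinates.
\<close>

lemma smooth_annulus_map_continuous:
  fixes H :: "circle \<times> real \<Rightarrow> 'a::topological_space"
  assumes \<Phi>: "smooth_annulus_map \<Phi>" and H: "continuous_on UNIV (\<lambda>w. H (annulus_proj w))"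
  shows "continuous_on strip (\<lambda>w. H (\<Phi> (annulus_proj w)))"
proof (rule continuous_on_locally)
  fix z assume "z \<in> strip"
  then obtain U F where U: "open U" "z \<in> U" "smooth_on F U"
    "\<And>w. w \<in> U \<inter> strip \<Longrightarrow> annulus_proj (F w) = \<Phi> (annulus_proj w)"
    using \<Phi> unfolding smooth_annulus_map_def local_lift_def by blast
  have "continuous_on (U \<inter> strip) F"
    using smooth_on_imp_continuous_on[OF U(3)] continuous_on_subset by blast
  then have "continuous_on (U \<inter> strip) (\<lambda>w. H (annulus_proj (F w)))"
    by (rule continuous_on_compose2[OF H]) simp
  then have "continuous_on (U \<inter> strip) (\<lambda>w. H (\<Phi> (annulus_proj w)))"
    by (rule continuous_on_eq) (simp add: U(4))
  with U show "\<exists>U. open U \<and> z \<in> U \<and> continuous_on (U \<inter> strip) (\<lambda>w. H (\<Phi> (annulus_proj w)))"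
    by blast
qed

text \<open>
The circle coordinate of \<open>\<Phi>\<close>, viewed in the unit circle of the complex plane, is a continuous
nowhere vanishing function on the contractible strip. Its continuous logarithm is the lift.
\<close>

lemma smooth_annulus_map_has_lift:
  assumes "smooth_annulus_map \<Phi>" obtains F where "is_lift \<Phi> F"
proof -
  define e where "e s = cis (2 * pi * rep_circle s)" for s
  have e_of: "e (circle_of x) = cis (2 * pi * x)" for x
  proof -
    have "rep_circle (circle_of x) - x \<in> \<int>" by (simp flip: circle_of_eq_iff)
    then obtain n where "rep_circle (circle_of x) = x + of_int n" by (auto elim!: Ints_cases simp: algebra_simps)
    then show ?thesis
      by (simp add: e_def distrib_left cis_mult[symmetric] cis_multiple_2pi)
  qed
  have "continuous_on strip (\<lambda>w. e (fst (\<Phi> (annulus_proj w))))"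
    by (rule smooth_annulus_map_continuous[OF assms])
      (simp add: annulus_proj_def e_of, intro continuous_intros)
  then obtain l where l: "continuous_on strip l"
    "\<And>w. w \<in> strip \<Longrightarrow> e (fst (\<Phi> (annulus_proj w))) = exp (l w)"
    by (rule continuous_logarithm_on_contractible[OF _ convex_imp_contractible[OF convex_strip]])
      (auto simp: e_def)
  have snd: "continuous_on strip (\<lambda>w. snd (\<Phi> (annulus_proj w)))"
    by (rule smooth_annulus_map_continuous[OF assms])
      (simp add: annulus_proj_def, intro continuous_intros)
  define F where "F w = (Im (l w) / (2 * pi), snd (\<Phi> (annulus_proj w)))" for w
  have "annulus_proj (F w) = \<Phi> (annulus_proj w)" if w: "w \<in> strip" for w
  proof -
    define r where "r = rep_circle (fst (\<Phi> (annulus_proj w)))"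
    have ex: "exp (l w) = cis (2 * pi * r)" using l(2)[OF w] by (simp add: e_def r_def)
    then have "exp (Re (l w)) = 1" by (metis norm_cis norm_exp_eq_Re)
    then have "l w = \<i> * of_real (Im (l w))" by (simp add: complex_eq_iff)
    then have "cis (Im (l w)) = cis (2 * pi * r)" using ex by (metis cis_conv_exp)
    then have "sin (Im (l w)) = sin (2 * pi * r) \<and> cos (Im (l w)) = cos (2 * pi * r)"
      by (simp add: complex_eq_iff)
    then obtain n :: int where "Im (l w) = 2 * pi * r + 2 * pi * n"
      by (auto simp: sin_cos_eq_iff)
    then have "Im (l w) / (2 * pi) = r + of_int n" by (simp add: field_simps)
    then have "circle_of (Im (l w) / (2 * pi)) = fst (\<Phi> (annulus_proj w))"
      by (simp add: r_def)
    then show ?thesis by (simp add: F_def annulus_proj_def)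
  qed
  moreover have "continuous_on strip F"
    unfolding F_def by (intro continuous_intros l snd) auto
  ultimately show thesis using that[of F] unfolding is_lift_def by blast
qed

section \<open>Conjugate tables\<close>

locale conjugate_tables = A: table \<Omega> \<xi> + B: table \<Omega>' \<xi>'
  for \<Omega> \<Omega>' :: "complex set" and \<xi> \<xi>' :: "circle \<Rightarrow> complex" +
  fixes \<Phi> :: "circle \<times> real \<Rightarrow> circle \<times> real" and F :: "real \<times> real \<Rightarrow> real \<times> real"
  assumes exact: "exact_symplectic \<Phi>"
    and conjugate: "\<And>z. z \<in> annulus \<Longrightarrow> \<Phi> (billiard_map \<xi>' z) = billiard_map \<xi> (\<Phi> z)"
    and lift: "is_lift \<Phi> F"
begin

lemma bij_on_annulus: "bij_betw \<Phi> annulus annulus" and smooth_map: "smooth_annulus_map \<Phi>"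
  using exact by (auto simp: exact_symplectic_def annulus_diffeomorphism_def)

lemma annulus_inj: "z \<in> annulus \<Longrightarrow> w \<in> annulus \<Longrightarrow> \<Phi> z = \<Phi> w \<Longrightarrow> z = w"
  using bij_betw_imp_inj_on[OF bij_on_annulus] by (simp add: inj_on_eq_iff)

lemma lift_proj: "z \<in> strip \<Longrightarrow> annulus_proj (F z) = \<Phi> (annulus_proj z)"
  and lift_continuous: "continuous_on strip F"
  using lift unfolding is_lift_def by blast+

text \<open>
A conjugacy matches fixed points, and the fixed points of a billiard map are exactly the boundary
states.
\<close>

lemma interior_iff:
  assumes "z \<in> annulus"
  shows "0 < snd (\<Phi> z) \<and> snd (\<Phi> z) < pi \<longleftrightarrow> 0 < snd z \<and> snd z < pi"
proof -
  have "billiard_map \<xi> (\<Phi> z) = \<Phi> z \<longleftrightarrow> \<Phi> (billiard_map \<xi>' z) = \<Phi> z"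
    using conjugate[OF assms] by simp
  also have "\<dots> \<longleftrightarrow> billiard_map \<xi>' z = z"
    using annulus_inj[OF B.billiard_map_in_annulus[OF assms] assms] by auto
  finally show ?thesis unfolding A.billiard_map_fixed_iff B.billiard_map_fixed_iff by argo
qed

lemma lift_interior:
  assumes "0 < v" "v < pi" shows "0 < snd (F (x, v))" "snd (F (x, v)) < pi"
proof -
  have xv: "(x, v) \<in> strip" using assms by (auto simp: strip_def)
  have "snd (F (x, v)) = snd (\<Phi> (annulus_proj (x, v)))"
    using lift_proj[OF xv] by (metis annulus_proj_def snd_conv)
  moreover have "0 < snd (\<Phi> (annulus_proj (x, v))) \<and> snd (\<Phi> (annulus_proj (x, v))) < pi"
    using interior_iff[of "annulus_proj (x, v)"] xv assms by (simp add: annulus_proj_def annulus_def)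
  ultimately show "0 < snd (F (x, v))" "snd (F (x, v)) < pi" by auto
qed

lemma lift_translation:
  obtains m :: int where
    "\<And>x v n. (x, v) \<in> strip \<Longrightarrow> F (x + real n, v) = F (x, v) + (of_int (m * int n), 0)"
proof -
  have tr: "z + (1, 0) \<in> strip \<and> annulus_proj (z + (1, 0)) = annulus_proj z" if "z \<in> strip" for z :: "real \<times> real"
    using that by (cases z) (auto simp: strip_def annulus_proj_def)
  have int: "fst (F (z + (1, 0))) - fst (F z) \<in> \<int>" "snd (F (z + (1, 0))) = snd (F z)" if z: "z \<in> strip" for z
  proof -
    have "annulus_proj (F (z + (1, 0))) = annulus_proj (F z)"
      using lift_proj[OF z] lift_proj[of "z + (1, 0)"] tr[OF z] by simp
    then show "fst (F (z + (1, 0))) - fst (F z) \<in> \<int>" "snd (F (z + (1, 0))) = snd (F z)"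
      unfolding annulus_proj_eq_iff by auto
  qed
  have "continuous_on strip (\<lambda>z. fst (F (z + (1, 0))) - fst (F z))"
    by (intro continuous_intros lift_continuous continuous_on_compose2[OF lift_continuous]) (use tr in auto)
  then obtain m where m: "\<And>z. z \<in> strip \<Longrightarrow> fst (F (z + (1, 0))) - fst (F z) = of_int m"
    using Ints_valued_constant[OF convex_connected[OF convex_strip]] int(1) by blast
  have step: "F (x + 1, v) = F (x, v) + (of_int m, 0)" if "(x, v) \<in> strip" for x v
    using m[OF that] int(2)[OF that] by (simp add: prod_eq_iff algebra_simps)
  have "F (x + real n, v) = F (x, v) + (of_int (m * int n), 0)" if "(x, v) \<in> strip" for x v n
  proof (induction n)
    case (Suc n)
    have "(x + real n, v) \<in> strip" using that by (simp add: strip_def)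
    from step[OF this] Suc show ?case by (simp add: algebra_simps prod_eq_iff)
  qed (simp add: prod_eq_iff)
  then show thesis using that by blast
qed

text \<open>
The continuous lift \<open>F\<close> and a smooth local lift \<open>G\<close> differ near an interior point by a constant
integer translation, so \<open>F\<close> inherits the derivative, and the equation
\<open>\<Phi>\<^sup>*\<alpha> - \<alpha> = dg\<close> may be read in terms of \<open>F\<close>.
\<close>

lemma lift_has_derivative:
  assumes z: "z \<in> interior strip" and g: "\<And>U G z. local_lift \<Phi> U G \<Longrightarrow> z \<in> U \<inter> strip \<Longrightarrow>
    ((\<lambda>y. g (annulus_proj y)) has_derivative
      (\<lambda>w. alpha_form (G z) (frechet_derivative G (at z) w) - alpha_form z w)) (at z within strip)"
  obtains F' where "(F has_derivative F') (at z)"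
    "((\<lambda>y. g (annulus_proj y)) has_derivative (\<lambda>w. alpha_form (F z) (F' w) - alpha_form z w)) (at z)"
proof -
  have zs: "z \<in> strip" using z interior_subset by blast
  then obtain U G where U: "z \<in> U" and loc: "local_lift \<Phi> U G"
    using smooth_map by (auto simp: smooth_annulus_map_def)
  then have opn: "open U" and sm: "smooth_on G U"
    and pr: "\<And>y. y \<in> U \<inter> strip \<Longrightarrow> annulus_proj (G y) = annulus_proj (F y)"
    using lift_proj by (auto simp: local_lift_def)
  define D where "D y = fst (F y) - fst (G y)" for y
  have same: "D y \<in> \<int>" "snd (F y) = snd (G y)" if "y \<in> U \<inter> strip" for y
    using pr[OF that, symmetric] unfolding annulus_proj_eq_iff D_def by auto
  have dG: "(G has_derivative frechet_derivative G (at z)) (at z)"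
    using smooth_on_imp_differentiable[OF sm U] by (simp add: frechet_derivative_works)
  have nhd: "\<forall>\<^sub>F y in nhds z. y \<in> U \<and> y \<in> interior strip"
    using U z opn by (intro eventually_conj eventually_nhds_in_open) auto
  have "isCont F z"
    using lift_continuous z continuous_on_interior by blast
  moreover have "isCont G z" using dG has_derivative_continuous by blast
  ultimately have "isCont D z" unfolding D_def by (intro continuous_intros)
  then have "\<forall>\<^sub>F y in nhds z. dist (D y) (D z) < 1"
    using tendstoD[of D "D z" "nhds z" 1] by (simp add: continuous_at tendsto_at_iff_tendsto_nhds)
  with nhd have "\<forall>\<^sub>F y in nhds z. F y = G y + (D z, 0)"
  proof eventually_elim
    case (elim y)
    then have "y \<in> U \<inter> strip" using interior_subset by blast
    from same[OF this] same[of z] have "D y - D z \<in> \<int>" "snd (F y) = snd (G y)" using U zs by auto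
    then have "D y = D z" using elim Ints_nonzero_abs_less1[of "D y - D z"] by (simp add: dist_real_def)
    then show ?case using \<open>snd (F y) = snd (G y)\<close> by (simp add: prod_eq_iff D_def)
  qed
  then have ev: "\<forall>\<^sub>F y in nhds z. G y + (D z, 0) = F y" by (rule eventually_mono) simp
  have "((\<lambda>y. G y + (D z, 0)) has_derivative frechet_derivative G (at z)) (at z)"
    using dG by (auto intro!: derivative_eq_intros)
  then have 1: "(F has_derivative frechet_derivative G (at z)) (at z)"
    by (rule has_derivative_transform_eventually)
      (use ev eventually_nhds_x_imp_x[OF ev] in \<open>auto simp: eventually_at_filter elim: eventually_mono\<close>)
  have "snd (G z) = snd (F z)" using same[of z] U zs by auto
  moreover have "at z within strip = at z" using z by (rule at_within_interior)
  ultimately have 2: "((\<lambda>y. g (annulus_proj y)) has_derivative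
      (\<lambda>w. alpha_form (F z) (frechet_derivative G (at z) w) - alpha_form z w)) (at z)"
    using g[OF loc, of z] U zs by (simp add: alpha_form_def)
  from 1 2 show thesis by (rule that)
qed

lemma primitive_exists:
  obtains g where "continuous_on strip (\<lambda>y. g (annulus_proj y) :: real)"
    "\<And>z. z \<in> interior strip \<Longrightarrow> \<exists>F'. (F has_derivative F') (at z) \<and>
      ((\<lambda>y. g (annulus_proj y)) has_derivative (\<lambda>w. alpha_form (F z) (F' w) - alpha_form z w)) (at z)"
proof -
  obtain g where g: "\<And>U G z. local_lift \<Phi> U G \<Longrightarrow> z \<in> U \<inter> strip \<Longrightarrow>
    ((\<lambda>y. g (annulus_proj y)) has_derivative
      (\<lambda>w. alpha_form (G z) (frechet_derivative G (at z) w) - alpha_form z w)) (at z within strip)"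
    using exact unfolding exact_symplectic_def by blast
  have "continuous_on strip (\<lambda>y. g (annulus_proj y))"
    unfolding continuous_on_eq_continuous_within
  proof (rule ballI)
    fix z assume "z \<in> strip"
    then obtain U G where "z \<in> U \<inter> strip" "local_lift \<Phi> U G"
      using smooth_map by (auto simp: smooth_annulus_map_def)
    from g[OF this(2,1)] show "continuous (at z within strip) (\<lambda>y. g (annulus_proj y))"
      by (rule has_derivative_continuous)
  qed
  moreover have "\<exists>F'. (F has_derivative F') (at z) \<and>
      ((\<lambda>y. g (annulus_proj y)) has_derivative (\<lambda>w. alpha_form (F z) (F' w) - alpha_form z w)) (at z)"
    if "z \<in> interior strip" for z
  proof (rule lift_has_derivative[OF that])
    show "((\<lambda>y. g (annulus_proj y)) has_derivative
        (\<lambda>w. alpha_form (G z) (frechet_derivative G (at z) w) - alpha_form z w)) (at z within strip)"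
      if "local_lift \<Phi> U G" "z \<in> U \<inter> strip" for U G z using g[OF that] .
  qed blast
  ultimately show thesis using that by blast
qed

section \<open>Lengths and rotations under a conjugacy\<close>

lemma interior_strip: "interior strip = UNIV \<times> {0<..<pi}"
  by (simp add: strip_def interior_Times)

text \<open>
The conjugacy equation in chord coordinates: the images of the two states of a chord are, up to an
integer translation of the second, the two states of a chord of the other table.
\<close>

lemma chord_image:
  assumes xy: "x < y" "y < x + 1"
  defines "a \<equiv> fst (F (x, out_angle \<xi>' x y))"
  obtains b where "a < b" "b < a + 1" "snd (F (x, out_angle \<xi>' x y)) = out_angle \<xi> a b"
    "snd (F (y, in_angle \<xi>' x y)) = in_angle \<xi> a b" "fst (F (y, in_angle \<xi>' x y)) - b \<in> \<int>"
proof -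
  let ?z = "(x, out_angle \<xi>' x y)" and ?w = "(y, in_angle \<xi>' x y)"
  have v: "0 < out_angle \<xi>' x y" "out_angle \<xi>' x y < pi" using B.out_angle_bounds(1)[OF xy] by auto
  have in_strip: "?z \<in> strip" "?w \<in> strip" using v B.in_angle_bounds(1)[OF xy] by (auto simp: strip_def)
  obtain b where b: "a < b" "b < a + 1" "out_angle \<xi> a b = snd (F ?z)"
    by (rule A.out_angle_surj[OF lift_interior[OF v, of x], of a])
  have "annulus_proj (F ?w) = \<Phi> (billiard_map \<xi>' (annulus_proj ?z))"
    using lift_proj[OF in_strip(2)] B.billiard_map_chord[OF xy] by simp
  also have "\<dots> = billiard_map \<xi> (annulus_proj (F ?z))"
    using conjugate[of "annulus_proj ?z"] in_strip lift_proj by simp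
  also have "F ?z = (a, out_angle \<xi> a b)" using b(3) by (simp add: a_def prod_eq_iff)
  also have "billiard_map \<xi> (annulus_proj (a, out_angle \<xi> a b)) = annulus_proj (b, in_angle \<xi> a b)"
    by (rule A.billiard_map_chord[OF b(1,2)])
  finally show thesis using that[of b] b by (auto simp: annulus_proj_eq_iff)
qed

lemma chords_convex: "convex chords"
proof -
  have eq: "chords = {z. (-1, 1) \<bullet> z > 0} \<inter> {z. (-1, 1) \<bullet> z < 1}"
    by (auto simp: chords_def)
  show "convex chords" unfolding eq by (intro convex_Int convex_halfspace_gt convex_halfspace_lt)
qed

definition departure :: "real \<times> real \<Rightarrow> real \<times> real" where
  "departure z = (fst z, out_angle \<xi>' (fst z) (snd z))"

definition arrival :: "real \<times> real \<Rightarrow> real \<times> real" where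
  "arrival z = (snd z, in_angle \<xi>' (fst z) (snd z))"

lemma state_interior: "z \<in> chords \<Longrightarrow> departure z \<in> interior strip" "z \<in> chords \<Longrightarrow> arrival z \<in> interior strip"
  using B.out_angle_bounds(1)[of "fst z" "snd z"] B.in_angle_bounds(1)[of "fst z" "snd z"]
  by (auto simp: departure_def arrival_def interior_strip chords_def)

lemma states_have_derivative:
  assumes "z \<in> chords"
  obtains D0 D1 where "(departure has_derivative D0) (at z)" "(arrival has_derivative D1) (at z)"
    "\<And>h. fst (D0 h) = fst h" "\<And>h. fst (D1 h) = snd h"
proof -
  obtain o' i' where "((\<lambda>z. out_angle \<xi>' (fst z) (snd z)) has_derivative o') (at z)"
    "((\<lambda>z. in_angle \<xi>' (fst z) (snd z)) has_derivative i') (at z)"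
    using B.angles_differentiable[OF assms] by (auto simp: differentiable_def)
  then have "(departure has_derivative (\<lambda>h. (fst h, o' h))) (at z)" "(arrival has_derivative (\<lambda>h. (snd h, i' h))) (at z)"
    unfolding departure_def[abs_def] arrival_def[abs_def] by (auto intro!: derivative_eq_intros)
  then show thesis using that by simp
qed

lemma continuous_states: "continuous_on chords departure" "continuous_on chords arrival"
proof -
  have "isCont departure z \<and> isCont arrival z" if z: "z \<in> chords" for z
  proof -
    obtain D0 D1 where "(departure has_derivative D0) (at z)" "(arrival has_derivative D1) (at z)"
      using states_have_derivative[OF z] by metis
    then show ?thesis using has_derivative_continuous by blast
  qed
  then show "continuous_on chords departure" "continuous_on chords arrival"
    by (auto intro!: continuous_at_imp_continuous_on)
qed

lemma continuous_chords_comp: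
  assumes "continuous_on strip f"
  shows "continuous_on chords (\<lambda>z. f (departure z))" "continuous_on chords (\<lambda>z. f (arrival z))"
  using state_interior interior_subset[of strip]
  by (auto intro!: continuous_on_compose2[OF assms] continuous_states)

text \<open>
As a chord shrinks to a point both of its states approach the boundary circle of angle \<open>0\<close>. All
constants of integration are evaluated in this limit.
\<close>

lemma grazing_limit:
  fixes f :: "real \<times> real \<Rightarrow> 'a::topological_space"
  assumes f: "continuous_on strip f"
  shows "((\<lambda>y. f (departure (0, y))) \<longlongrightarrow> f (0, 0)) (at_right 0)" "((\<lambda>y. f (arrival (0, y))) \<longlongrightarrow> f (0, 0)) (at_right 0)"
proof -
  have ev: "\<forall>\<^sub>F y in at_right 0. departure (0, y) \<in> strip \<and> arrival (0, y) \<in> strip"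
    using eventually_at_right_real[OF zero_less_one]
    by eventually_elim (use state_interior interior_subset in \<open>force simp: chords_def\<close>)
  have 0: "(0, 0) \<in> strip" by (simp add: strip_def)
  have "((\<lambda>y. departure (0, y)) \<longlongrightarrow> (0, 0)) (at_right 0)"
    unfolding departure_def using tendsto_Pair[OF tendsto_const B.out_angle_at_right] by simp
  then show "((\<lambda>y. f (departure (0, y))) \<longlongrightarrow> f (0, 0)) (at_right 0)"
    by (rule continuous_on_tendsto_compose[OF f _ 0]) (use ev in \<open>auto elim: eventually_mono\<close>)
  have "((\<lambda>y. arrival (0, y)) \<longlongrightarrow> (0, 0)) (at_right 0)"
    unfolding arrival_def using tendsto_Pair[OF tendsto_ident_at B.in_angle_at_right] by simp
  then show "((\<lambda>y. f (arrival (0, y))) \<longlongrightarrow> f (0, 0)) (at_right 0)"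
    by (rule continuous_on_tendsto_compose[OF f _ 0]) (use ev in \<open>auto elim: eventually_mono\<close>)
qed

text \<open>
The image of a chord is a chord up to translation by an integer, so the advance of the lifted base
point is never an integer, and its integer part \<open>k\<close> is the same for all chords. For shrinking chords
the advance tends to \<open>0\<close>, which leaves the values \<open>0\<close> and \<open>-1\<close>. The second one belongs to maps that
exchange the boundary circles of the annulus.
\<close>

lemma advance_integer_part:
  obtains k :: int where "k = -1 \<or> k = 0"
    "\<And>z. z \<in> chords \<Longrightarrow> of_int k < fst (F (arrival z)) - fst (F (departure z)) \<and> fst (F (arrival z)) - fst (F (departure z)) < of_int k + 1"
proof -
  define d where "d z = fst (F (arrival z)) - fst (F (departure z))" for z
  have F1: "continuous_on strip (\<lambda>z. fst (F z))" by (intro continuous_intros lift_continuous)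
  have "continuous_on chords d"
    unfolding d_def by (intro continuous_on_diff continuous_chords_comp[OF F1])
  moreover have "d z \<notin> \<int>" if "z \<in> chords" for z
  proof
    assume "d z \<in> \<int>"
    have xy: "fst z < snd z" "snd z < fst z + 1" using that by (auto simp: chords_def)
    obtain b where b: "fst (F (departure z)) < b" "b < fst (F (departure z)) + 1" "fst (F (arrival z)) - b \<in> \<int>"
      using chord_image[OF xy] unfolding departure_def arrival_def by metis
    have "d z - (fst (F (arrival z)) - b) \<in> \<int>" using Ints_diff[OF \<open>d z \<in> \<int>\<close> b(3)] .
    then have "b - fst (F (departure z)) \<in> \<int>" by (simp add: d_def)
    then show False using b Ints_nonzero_abs_less1[of "b - fst (F (departure z))"] by auto
  qed
  ultimately obtain k :: int where k: "\<And>z. z \<in> chords \<Longrightarrow> of_int k < d z \<and> d z < of_int k + 1"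
    using floor_constant[OF convex_connected[OF chords_convex]] by blast
  have lim: "((\<lambda>y. d (0, y)) \<longlongrightarrow> 0) (at_right 0)"
    unfolding d_def using tendsto_diff[OF grazing_limit(2,1)[OF F1]] by simp
  have ev: "\<forall>\<^sub>F y in at_right 0. of_int k \<le> d (0, y) \<and> d (0, y) \<le> of_int k + 1"
    using eventually_at_right_real[OF zero_less_one]
    by eventually_elim (use k in \<open>force simp: chords_def\<close>)
  have "of_int k \<le> (0::real)"
    by (rule tendsto_lowerbound[OF lim]) (use ev in \<open>auto elim: eventually_mono\<close>)
  moreover have "(0::real) \<le> of_int k + 1"
    by (rule tendsto_upperbound[OF lim]) (use ev in \<open>auto elim: eventually_mono\<close>)
  ultimately have "k = -1 \<or> k = 0" by linarith
  with k show thesis using that by (auto simp: d_def)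
qed

text \<open>
The heart of the matter. Differentiating along chords, each term is known: the primitive \<open>g\<close> of
\<open>\<Phi>\<^sup>*\<alpha> - \<alpha>\<close> at the two states gives the cosines of the angles in both tables, and the chord lengths
give the same cosines by \<open>chord_length_has_derivative\<close>. They cancel, so the combination \<open>K\<close> below is
constant, and for shrinking chords every difference in it tends to \<open>0\<close>. Thus the conjugacy changes
the chord length only by a coboundary.
\<close>

lemma length_cocycle:
  obtains g :: "circle \<times> real \<Rightarrow> real" where "\<And>z. z \<in> chords \<Longrightarrow>
    norm (B.X (snd z) - B.X (fst z)) - norm (A.X (fst (F (arrival z))) - A.X (fst (F (departure z)))) =
    g (annulus_proj (arrival z)) - g (annulus_proj (departure z))"
proof -
  obtain g where gc: "continuous_on strip (\<lambda>y. g (annulus_proj y) :: real)" and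
    gd: "\<And>z. z \<in> interior strip \<Longrightarrow> \<exists>F'. (F has_derivative F') (at z) \<and>
      ((\<lambda>y. g (annulus_proj y)) has_derivative (\<lambda>w. alpha_form (F z) (F' w) - alpha_form z w)) (at z)"
    using primitive_exists by blast
  define K where "K z = g (annulus_proj (arrival z)) - g (annulus_proj (departure z))
     - norm (B.X (snd z) - B.X (fst z)) + norm (A.X (fst (F (arrival z))) - A.X (fst (F (departure z))))" for z
  have "(K has_derivative (\<lambda>h. 0)) (at z)" if z: "z \<in> chords" for z
  proof -
    have xy: "fst z < snd z" "snd z < fst z + 1" using z by (auto simp: chords_def)
    obtain b where b: "fst (F (departure z)) < b" "b < fst (F (departure z)) + 1"
      "snd (F (departure z)) = out_angle \<xi> (fst (F (departure z))) b" "snd (F (arrival z)) = in_angle \<xi> (fst (F (departure z))) b"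
      "fst (F (arrival z)) - b \<in> \<int>"
      using chord_image[OF xy] unfolding departure_def arrival_def by metis
    \<comment> \<open>The lifted image of the arrival point is \<open>b'\<close>, an integer translate of the end \<open>b\<close> of the
      image chord; the boundary curve does not see the difference.\<close>
    define a b' where "a = fst (F (departure z))" "b' = fst (F (arrival z))"
    have b': "A.X b' = A.X b" "A.\<tau> b' = A.\<tau> b" "chord_dir \<xi> a b' = chord_dir \<xi> a b"
      using A.bdry_add_Ints[OF b(5), of b] A.velocity_add_Ints[OF b(5), of b]
      by (auto simp: a_b'_def chord_dir_def)
    obtain D0 D1 where D: "(departure has_derivative D0) (at z)" "(arrival has_derivative D1) (at z)"
      "\<And>h. fst (D0 h) = fst h" "\<And>h. fst (D1 h) = snd h"
      using states_have_derivative[OF z] by blast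
    obtain F0 where F0: "(F has_derivative F0) (at (departure z))" "((\<lambda>y. g (annulus_proj y)) has_derivative
        (\<lambda>w. alpha_form (F (departure z)) (F0 w) - alpha_form (departure z) w)) (at (departure z))"
      using gd[OF state_interior(1)[OF z]] by blast
    obtain F1 where F1: "(F has_derivative F1) (at (arrival z))" "((\<lambda>y. g (annulus_proj y)) has_derivative
        (\<lambda>w. alpha_form (F (arrival z)) (F1 w) - alpha_form (arrival z) w)) (at (arrival z))"
      using gd[OF state_interior(2)[OF z]] by blast
    have dA: "((\<lambda>z. norm (A.X (fst (F (arrival z))) - A.X (fst (F (departure z))))) has_derivative
      (\<lambda>h. fst (F1 (D1 h)) * cos (snd (F (arrival z))) - fst (F0 (D0 h)) * cos (snd (F (departure z))))) (at z)"
    proof -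
      have "((\<lambda>z. fst (F (departure z))) has_derivative (\<lambda>h. fst (F0 (D0 h)))) (at z)"
        "((\<lambda>z. fst (F (arrival z))) has_derivative (\<lambda>h. fst (F1 (D1 h)))) (at z)"
        by (intro has_derivative_fst has_derivative_compose[OF D(1) F0(1)] has_derivative_compose[OF D(2) F1(1)])+
      from A.chord_length_has_derivative[OF this] show ?thesis
        using b' b(3,4) A.bdry_distinct[OF b(1,2)] A.cos_angles[OF b(1,2)] by (simp add: a_b'_def)
    qed
    have dB: "((\<lambda>z. norm (B.X (snd z) - B.X (fst z))) has_derivative
      (\<lambda>h. snd h * cos (snd (arrival z)) - fst h * cos (snd (departure z)))) (at z)"
      using B.chord_length_has_derivative[OF has_derivative_fst[OF has_derivative_ident] has_derivative_snd[OF has_derivative_ident], of z]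
        B.bdry_distinct[OF xy] B.cos_angles[OF xy] by (simp add: departure_def arrival_def)
    show ?thesis
      unfolding K_def[abs_def]
      by (rule has_derivative_eq_rhs[OF has_derivative_add[OF has_derivative_diff[OF has_derivative_diff[OF
            has_derivative_compose[OF D(2) F1(2)] has_derivative_compose[OF D(1) F0(2)]] dB] dA]])
        (simp add: alpha_form_def D fun_eq_iff)
  qed
  then obtain c where c: "\<And>z. z \<in> chords \<Longrightarrow> K z = c"
    using has_derivative_zero_constant[OF chords_convex, of K] has_derivative_at_withinI by blast
  have "((\<lambda>y. K (0, y)) \<longlongrightarrow> 0) (at_right 0)"
  proof -
    have AF: "continuous_on strip (\<lambda>z. A.X (fst (F z)))"
      by (intro continuous_on_compose2[OF A.continuous_bdry[of UNIV]] continuous_intros lift_continuous) auto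
    have "(B.X \<longlongrightarrow> B.X 0) (at_right 0)"
      using B.continuous_bdry[of UNIV] by (simp add: continuous_on_eq_continuous_at isCont_def filterlim_at_split)
    from tendsto_add[OF tendsto_diff[OF tendsto_diff[OF grazing_limit(2,1)[OF gc]]
          tendsto_norm[OF tendsto_diff[OF this tendsto_const[of "B.X 0"]]]]
        tendsto_norm[OF tendsto_diff[OF grazing_limit(2,1)[OF AF]]]]
    show ?thesis by (simp add: K_def)
  qed
  moreover have "\<forall>\<^sub>F y in at_right 0. K (0, y) = c"
    using eventually_at_right_real[OF zero_less_one]
    by eventually_elim (use c in \<open>auto simp: chords_def\<close>)
  ultimately have "((\<lambda>y. c) \<longlongrightarrow> 0) (at_right (0::real))" by (rule Lim_transform_eventually)
  then have "c = 0" by (simp add: tendsto_const_iff)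
  with c that[of g] show thesis by (force simp: K_def)
qed

section \<open>Transfer of closed orbits and invariance of the beta function\<close>

text \<open>
Orbits of the two tables are compared through their states in the annulus, where \<open>\<Phi>\<close> acts; the
parameters of an orbit are determined by the states only up to a common integer.
\<close>

definition seq_state :: "(circle \<Rightarrow> complex) \<Rightarrow> (nat \<Rightarrow> real) \<Rightarrow> nat \<Rightarrow> circle \<times> real" where
  "seq_state \<eta> x i = annulus_proj (x i, out_angle \<eta> (x i) (x (Suc i)))"

text \<open>
Images of orbits are orbits. Over one period the lift advances by \<open>m p\<close>, where \<open>m\<close> is its translation
under a full turn, and the correction by \<open>k\<close> at each of the \<open>q\<close> steps makes the rotation \<open>m p - k q\<close>;
the actions agree as the coboundary of \<open>length_cocycle\<close> sums to zero. The possible values of \<open>m\<close> follow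
from the existence of closed orbits with \<open>q = 3\<close> and \<open>p = 1, 2\<close>: their images must have rotation
strictly between \<open>0\<close> and \<open>3\<close>. The two cases are \<open>p \<mapsto> p\<close> and \<open>p \<mapsto> q - p\<close>.
\<close>

lemma orbit_transfer:
  obtains m k :: int where "m = 1 \<and> k = 0 \<or> m = -1 \<and> k = -1"
    "\<And>x. billiard_seq \<xi>' x \<Longrightarrow> \<exists>y. billiard_seq \<xi> y \<and>
       (\<forall>i. seq_state \<xi> y i = \<Phi> (seq_state \<xi>' x i)) \<and>
       (\<forall>p q. closed_seq \<xi>' (int p) q x \<longrightarrow>
         closed_seq \<xi> (m * int p - k * int q) q y \<and> action \<xi> q y = action \<xi>' q x)"
proof -
  obtain m :: int where m: "\<And>x v n. (x, v) \<in> strip \<Longrightarrow> F (x + real n, v) = F (x, v) + (of_int (m * int n), 0)"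
    using lift_translation by blast
  obtain k :: int where k: "k = -1 \<or> k = 0"
    "\<And>z. z \<in> chords \<Longrightarrow> of_int k < fst (F (arrival z)) - fst (F (departure z)) \<and> fst (F (arrival z)) - fst (F (departure z)) < of_int k + 1"
    using advance_integer_part by blast
  obtain g :: "circle \<times> real \<Rightarrow> real" where g: "\<And>z. z \<in> chords \<Longrightarrow>
    norm (B.X (snd z) - B.X (fst z)) - norm (A.X (fst (F (arrival z))) - A.X (fst (F (departure z)))) =
    g (annulus_proj (arrival z)) - g (annulus_proj (departure z))" using length_cocycle by blast
  have tr: "\<exists>y. billiard_seq \<xi> y \<and> (\<forall>i. seq_state \<xi> y i = \<Phi> (seq_state \<xi>' x i)) \<and>
       (\<forall>p q. closed_seq \<xi>' (int p) q x \<longrightarrow>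
         closed_seq \<xi> (m * int p - k * int q) q y \<and> action \<xi> q y = action \<xi>' q x)"
    if x: "billiard_seq \<xi>' x" for x
  proof -
    define z where "z i = (x i, x (Suc i))" for i
    have xs: "x i < x (Suc i)" "x (Suc i) < x i + 1"
      "in_angle \<xi>' (x i) (x (Suc i)) = out_angle \<xi>' (x (Suc i)) (x (Suc (Suc i)))" for i
      using x by (auto simp: billiard_seq_def)
    have zc: "z i \<in> chords" for i using xs[of i] by (simp add: z_def chords_def)
    have arrival_z: "arrival (z i) = departure (z (Suc i))" for i
      using xs(3)[of i] by (simp add: departure_def arrival_def z_def)
    have strip: "departure (z i) \<in> strip" for i
      using state_interior(1)[OF zc] interior_subset by blast
    \<comment> \<open>The lifted base points advance by a number in \<open>(k, k + 1)\<close> at each step; subtracting \<open>k\<close> per step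
      makes consecutive parameters the end points of a chord.\<close>
    define y where "y i = fst (F (departure (z i))) - of_int k * real i" for i
    have img: "y i < y (Suc i) \<and> y (Suc i) < y i + 1 \<and>
        snd (F (departure (z i))) = out_angle \<xi> (y i) (y (Suc i)) \<and>
        snd (F (departure (z (Suc i)))) = in_angle \<xi> (y i) (y (Suc i))" for i
    proof -
      let ?a = "fst (F (departure (z i)))"
      obtain b where b: "?a < b" "b < ?a + 1" "snd (F (departure (z i))) = out_angle \<xi> ?a b"
        "snd (F (arrival (z i))) = in_angle \<xi> ?a b" "fst (F (arrival (z i))) - b \<in> \<int>"
        using chord_image[OF xs(1,2)[of i]] unfolding departure_def arrival_def z_def by (metis fst_conv snd_conv)
      have "fst (F (arrival (z i))) - b - of_int k \<in> \<int>" using b(5) by simp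
      moreover have "\<bar>fst (F (arrival (z i))) - b - of_int k\<bar> < 1" using b(1,2) k(2)[OF zc[of i]] by linarith
      ultimately have "fst (F (arrival (z i))) - b - of_int k = 0" by (rule Ints_nonzero_abs_less1)
      then have bk: "b = fst (F (arrival (z i))) - of_int k" by simp
      define c where "c = - (of_int k * real i)"
      have c: "c \<in> \<int>" by (simp add: c_def)
      have "y i = ?a + c" "y (Suc i) = b + c"
        using arrival_z[of i] by (simp_all add: y_def bk c_def algebra_simps)
      then show ?thesis using b arrival_z[of i] c by simp
    qed
    have bs: "billiard_seq \<xi> y" unfolding billiard_seq_def using img by metis
    have state: "seq_state \<xi> y i = \<Phi> (seq_state \<xi>' x i)" for i
    proof -
      have "seq_state \<xi> y i = annulus_proj (F (departure (z i)))"
        using img[of i] by (simp add: seq_state_def annulus_proj_eq_iff) (simp add: y_def)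
      then show ?thesis using lift_proj[OF strip[of i]] by (simp add: seq_state_def departure_def z_def)
    qed
    have closed: "closed_seq \<xi> (m * int p - k * int q) q y \<and> action \<xi> q y = action \<xi>' q x"
      if "closed_seq \<xi>' (int p) q x" for p q
    proof -
      have per: "x (i + q) = x i + real p" for i
        using that by (simp add: closed_seq_def)
      have departure_per: "departure (z (i + q)) = (fst (departure (z i)) + real p, snd (departure (z i)))" for i
        using per[of i] per[of "Suc i"] by (simp add: departure_def z_def)
      have "y (i + q) = y i + of_int (m * int p - k * int q)" for i
        using m[of "fst (departure (z i))" "snd (departure (z i))" p] strip[of i] by (simp add: y_def departure_per algebra_simps)
      with bs have cl: "closed_seq \<xi> (m * int p - k * int q) q y" by (simp add: closed_seq_def)
      have Xy: "A.X (y i) = A.X (fst (F (departure (z i))))" for i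
        using A.bdry_add_Ints[of "- (of_int k * real i)" "fst (F (departure (z i)))"] by (simp add: y_def)
      define G where "G i = g (annulus_proj (departure (z i)))" for i
      have "h_fun \<xi> (y i) (y (Suc i)) - h_fun \<xi>' (x i) (x (Suc i)) = G (Suc i) - G i" for i
        using g[OF zc[of i]] by (simp add: h_fun_bdry Xy arrival_z G_def) (simp add: z_def)
      then have "action \<xi> q y - action \<xi>' q x = G q - G 0"
        unfolding action_def by (simp add: sum_subtractf[symmetric] sum_lessThan_telescope)
      also have "G q = G 0"
        using departure_per[of 0] by (auto simp: G_def annulus_proj_def)
      finally show ?thesis using cl by simp
    qed
    from bs state closed show ?thesis by blast
  qed
  have "0 < m * int p - k * 3 \<and> m * int p - k * 3 < 3" if p: "0 < p" "p < 3" for p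
  proof -
    obtain x where x: "closed_seq \<xi>' (int p) 3 x" using B.beta_frac_attained[OF p] by blast
    then have "billiard_seq \<xi>' x" by (simp add: closed_seq_def)
    from tr[OF this] x obtain y where "closed_seq \<xi> (m * int p - k * int 3) 3 y" by blast
    from A.closed_seq_rotation_bounds[OF this] show ?thesis by simp
  qed
  from this[of 1] this[of 2] k(1) have "m = 1 \<and> k = 0 \<or> m = -1 \<and> k = -1" by auto
  with tr show thesis using that by blast
qed

text \<open>
Surjectivity of \<open>\<Phi>\<close> yields an orbit over a given closed orbit and injectivity makes it close up.
The relation \<open>Q\<close> stands for whatever the transfer of orbits provides in addition; its image sequence
can differ from the given orbit only by an integer translation.
\<close>

lemma closed_orbit_preimage:
  assumes image: "\<And>x. billiard_seq \<xi>' x \<Longrightarrow> \<exists>y. billiard_seq \<xi> y \<and>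
       (\<forall>i. seq_state \<xi> y i = \<Phi> (seq_state \<xi>' x i)) \<and> Q x y"
    and y: "closed_seq \<xi> p q y" and q: "q > 0"
  obtains x y' n r where "closed_seq \<xi>' (int r) q x" "Q x y'" "n \<in> \<int>" "\<And>i. y' i = y i + n"
proof -
  have ys: "y i < y (Suc i)" "y (Suc i) < y i + 1" "billiard_seq \<xi> y" "y (i + q) = y i + of_int p" for i
    using y by (auto simp: closed_seq_def billiard_seq_def)
  have "seq_state \<xi> y 0 \<in> annulus"
    using A.out_angle_bounds(1)[OF ys(1,2)[of 0]] by (simp add: seq_state_def strip_def)
  then obtain w where w: "w \<in> annulus" "\<Phi> w = seq_state \<xi> y 0"
    using bij_on_annulus by (metis bij_betw_imp_surj_on imageE)
  have "0 < snd w \<and> snd w < pi"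
    using interior_iff[OF w(1)] A.out_angle_bounds(1)[OF ys(1,2)[of 0]] w(2)
    by (simp add: seq_state_def annulus_proj_def)
  then obtain x where x: "billiard_seq \<xi>' x" "x 0 = rep_circle (fst w)" "out_angle \<xi>' (rep_circle (fst w)) (x 1) = snd w"
    using B.billiard_seq_exists by blast
  have x0: "seq_state \<xi>' x 0 = w" using x(2,3) by (simp add: seq_state_def)
  obtain y' where y': "billiard_seq \<xi> y'" "\<And>i. seq_state \<xi> y' i = \<Phi> (seq_state \<xi>' x i)" "Q x y'"
    using image[OF x(1)] by blast
  define n where "n = y' 0 - y 0"
  have "seq_state \<xi> y' 0 = seq_state \<xi> y 0" using y'(2)[of 0] x0 w by simp
  then have n: "n \<in> \<int>" and ang: "out_angle \<xi> (y' 0) (y' 1) = out_angle \<xi> (y 0) (y 1)"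
    by (auto simp: seq_state_def annulus_proj_eq_iff n_def)
  have yn: "y' i = y i + n" for i
    by (rule A.billiard_seq_rigid[OF ys(3) y'(1) n _ ang]) (simp add: n_def)
  have st: "seq_state \<xi>' x i \<in> annulus" for i
    using B.out_angle_bounds(1)[of "x i" "x (Suc i)"] x(1)
    by (auto simp: seq_state_def strip_def billiard_seq_def intro: less_imp_le)
  have "seq_state \<xi> y' q = seq_state \<xi> y' 0"
    using ys(4)[of 0] ys(4)[of 1] n by (simp add: seq_state_def annulus_proj_eq_iff yn)
  then have "seq_state \<xi>' x q = seq_state \<xi>' x 0"
    using annulus_inj[OF st st] y'(2) by metis
  then have r: "x q - x 0 \<in> \<int>" and ang': "out_angle \<xi>' (x q) (x (Suc q)) = out_angle \<xi>' (x 0) (x 1)"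
    by (auto simp: seq_state_def annulus_proj_eq_iff)
  then obtain r where r: "x q - x 0 = of_int r" by (auto elim: Ints_cases)
  have "billiard_seq \<xi>' (\<lambda>i. x (i + q))" using x(1) by (auto simp: billiard_seq_def)
  then have "x (i + q) = x i + of_int r" for i
    using B.billiard_seq_rigid[OF x(1), of "\<lambda>i. x (i + q)" "of_int r" i] r ang' by simp
  with x(1) have cl: "closed_seq \<xi>' r q x" by (simp add: closed_seq_def)
  with B.closed_seq_rotation_bounds[OF this q] have "closed_seq \<xi>' (int (nat r)) q x" by simp
  from that[OF this y'(3) n yn] show thesis .
qed

text \<open>
A minimizing closed orbit of either table corresponds to a closed orbit of the other one with the same
action and the same rotation up to reversal, and reversal does not change the minimum.
\<close>

lemma beta_frac_invariant:
  assumes pq: "0 < p" "p < q"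
  shows "beta_frac \<xi> p q = beta_frac \<xi>' p q"
proof -
  obtain m k :: int where mk: "m = 1 \<and> k = 0 \<or> m = -1 \<and> k = -1"
    and image: "\<And>x. billiard_seq \<xi>' x \<Longrightarrow> \<exists>y. billiard_seq \<xi> y \<and>
       (\<forall>i. seq_state \<xi> y i = \<Phi> (seq_state \<xi>' x i)) \<and>
       (\<forall>p q. closed_seq \<xi>' (int p) q x \<longrightarrow>
         closed_seq \<xi> (m * int p - k * int q) q y \<and> action \<xi> q y = action \<xi>' q x)"
    using orbit_transfer by blast
  define r where "r p = nat (m * int p - k * int q)" for p
  have r: "m * int p - k * int q = int (r p)" "0 < r p" "r p < q" "r p = p \<or> r p = q - p"
    "beta_frac \<xi> (r p) q = beta_frac \<xi> p q" if "0 < p" "p < q" for p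
    using mk that A.beta_frac_reverse[OF that]
    by (auto simp: r_def of_nat_diff nat_diff_distrib)
  have q: "q > 0" using pq by simp
  have "real q * beta_frac \<xi> p q \<le> real q * beta_frac \<xi>' p q"
  proof -
    obtain x where x: "closed_seq \<xi>' (int p) q x" "action \<xi>' q x = real q * beta_frac \<xi>' p q"
      using B.beta_frac_attained[OF pq] by blast
    then have "billiard_seq \<xi>' x" by (simp add: closed_seq_def)
    from image[OF this] x obtain y where y: "closed_seq \<xi> (int (r p)) q y" "action \<xi> q y = action \<xi>' q x"
      using r(1)[OF pq] by metis
    have "real q * beta_frac \<xi> (r p) q \<le> action \<xi> q y"
      by (rule A.beta_frac_le_action[OF r(2,3)[OF pq] A.closed_seq_config[OF y(1) refl]])
    then show ?thesis using x(2) y(2) r(5)[OF pq] by simp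
  qed
  moreover have "real q * beta_frac \<xi>' p q \<le> real q * beta_frac \<xi> p q"
  proof -
    obtain y where y: "closed_seq \<xi> (int p) q y" "action \<xi> q y = real q * beta_frac \<xi> p q"
      using A.beta_frac_attained[OF pq] by blast
    obtain x y' n j where x: "closed_seq \<xi>' (int j) q x" and n: "n \<in> \<int>" and y': "\<And>i. y' i = y i + n"
      and Q: "\<forall>p q. closed_seq \<xi>' (int p) q x \<longrightarrow>
         closed_seq \<xi> (m * int p - k * int q) q y' \<and> action \<xi> q y' = action \<xi>' q x"
      by (rule closed_orbit_preimage[OF image y(1) q]) auto
    have j: "0 < j" "j < q" using B.closed_seq_rotation_bounds[OF x q] by auto
    have y'c: "closed_seq \<xi> (int (r j)) q y'" and act: "action \<xi> q y' = action \<xi>' q x"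
      using Q x r(1)[OF j] by metis+
    have "y' = (\<lambda>i. y i + n)" using y' by auto
    then have "action \<xi> q y' = action \<xi> q y" using A.action_add_Ints[OF n] by simp
    have "real (r j) = real p"
      using y'c y(1) y'[of 0] y'[of q] unfolding closed_seq_def by (metis add_0 add_left_cancel add.assoc add.commute of_int_of_nat_eq)
    then have "p = j \<or> p = q - j" using r(4)[OF j] by auto
    then have "beta_frac \<xi>' p q = beta_frac \<xi>' j q" using B.beta_frac_reverse[OF j] by auto
    moreover have "real q * beta_frac \<xi>' j q \<le> action \<xi>' q x"
      by (rule B.beta_frac_le_action[OF j B.closed_seq_config[OF x refl]])
    ultimately show ?thesis using act \<open>action \<xi> q y' = action \<xi> q y\<close> y(2) by simp
  qed
  ultimately show ?thesis using q by simp
qed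

end

theorem theorem1p11:
  fixes \<Omega> \<Omega>' :: "complex set" and \<xi> \<xi>' :: "circle \<Rightarrow> complex"
    and \<Phi> :: "circle \<times> real \<Rightarrow> circle \<times> real"
  assumes "billiard_domain \<Omega> \<xi>" and "billiard_domain \<Omega>' \<xi>'"
    and "exact_symplectic \<Phi>"
    and "\<forall>z\<in>annulus. \<Phi> (billiard_map \<xi>' z) = billiard_map \<xi> (\<Phi> z)"
  shows "\<forall>h\<in>{0<..1/2}. beta \<xi> h = beta \<xi>' h"
proof -
  obtain F where F: "is_lift \<Phi> F"
    using smooth_annulus_map_has_lift assms(3) by (auto simp: exact_symplectic_def annulus_diffeomorphism_def)
  interpret conjugate_tables \<Omega> \<Omega>' \<xi> \<xi>' \<Phi> F
    using assms F by unfold_locales auto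
  have rat: "beta_rat \<xi> h = beta_rat \<xi>' h" if h: "h \<in> {0<..1/2}" for h
  proof -
    have "beta_frac \<xi> p q = beta_frac \<xi>' p q" if "q > 0" "h = real p / real q" for p q
    proof (rule beta_frac_invariant)
      show "0 < p" using h that by (auto intro: gr0I)
      have "real p \<le> real q / 2" using h that by (simp add: field_simps)
      then show "p < q" using that(1) by simp
    qed
    \<comment> \<open>The two values are defined by the same description, whether or not it determines them.\<close>
    then have "(\<lambda>b. \<exists>p q. q > 0 \<and> coprime p q \<and> h = real p / real q \<and> b = beta_frac \<xi> p q) =
      (\<lambda>b. \<exists>p q. q > 0 \<and> coprime p q \<and> h = real p / real q \<and> b = beta_frac \<xi>' p q)"
      by (intro ext) metis
    then show ?thesis by (simp add: beta_rat_def)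
  qed
  show ?thesis
  proof
    fix h :: real assume h: "h \<in> {0<..1/2}"
    have "(\<lambda>n. beta_rat \<xi> (r n)) = (\<lambda>n. beta_rat \<xi>' (r n))"
      if "\<forall>n. r n \<in> \<rat> \<inter> {0<..1/2}" for r :: "nat \<Rightarrow> real"
      using that rat by auto
    then have "(\<lambda>l. \<forall>r :: nat \<Rightarrow> real. (\<forall>n. r n \<in> \<rat> \<inter> {0<..1/2}) \<and> r \<longlonglongrightarrow> h \<longrightarrow> (\<lambda>n. beta_rat \<xi> (r n)) \<longlonglongrightarrow> l) =
      (\<lambda>l. \<forall>r :: nat \<Rightarrow> real. (\<forall>n. r n \<in> \<rat> \<inter> {0<..1/2}) \<and> r \<longlonglongrightarrow> h \<longrightarrow> (\<lambda>n. beta_rat \<xi>' (r n)) \<longlonglongrightarrow> l)"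
      by (intro ext) metis
    then show "beta \<xi> h = beta \<xi>' h" using rat[OF h] by (simp add: beta_def)
  qed
qed

end
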